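(* Let $(M(c),\varphi,\xi,\eta,g)$ be a conformal Kenmotsu space form and let $\acute{M}$ be a CR-hypersurface of $M(c)$ with unit normal vector field $N$ whose shape operator $A$ is parallel. Suppose that the Lee vector field satisfies $\omega^{\sharp}=N$ along $\acute{M}$. Then $\acute{M}$ is totally umbilic.
   Context: An almost contact metric structure $(\varphi,\xi,\eta,g)$ on a $(2n+1)$-dimensional smooth manifold $M$ consists of a $(1,1)$-tensor field $\varphi$, a vector field $\xi$, a 1-form $\eta$ and a Riemannian metric $g$ with $\varphi^2=-\mathrm{Id}+\eta\otimes\xi$, $\eta(\xi)=1$, $\varphi\xi=0$, $\eta\circ\varphi=0$, $g(\varphi X,\varphi Y)=g(X,Y)-\eta(X)\eta(Y)$, $\eta(X)=g(X,\xi)$. It is a Kenmotsu structure if $(\nabla_X\varphi)Y=-g(X,\varphi Y)\xi-\eta(Y)\varphi X$, with $\nabla$ the Levi-Civita connection of $g$. $(M,\varphi,\xi,\eta,g)$ is a conformal Kenmotsu manifold if there is a positive smooth function $f:M\to\mathbb{R}$ (fixed throughout) such that $(\varphi,\ \tilde\xi=e^{-f/2}\xi,\ \tilde\eta=e^{f/2}\eta,\ \tilde g=e^{f}g)$ is a Kenmotsu structure on $M$. It is a conformal Kenmotsu space form, denoted $M(c)$, if moreover this Kenmotsu structure has constant $\varphi$-holomorphic sectional curvature $c$, i.e. the $\tilde g$-sectional curvature of $\mathrm{span}\{X,\varphi X\}$ equals the constant $c$ for all nonzero $X$ orthogonal to $\tilde\xi$. The 1-form $\omega$ is $\omega(X)=X(f)$,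 and the Lee vector field is $\omega^{\sharp}=\mathrm{grad} f$ (gradient with respect to $g$). A CR-hypersurface of $M$ is a $2n$-dimensional embedded submanifold $\acute{M}$ such that $\xi$ is tangent to $\acute{M}$ and $T\acute{M}$ is an orthogonal direct sum of distributions $D\oplus D^{\perp}$ with $\varphi(D_p)\subset D_p$ and $\varphi(D^{\perp}_p)\subset T_p^{\perp}\acute{M}$ for all $p\in\acute M$. With $N$ a unit normal vector field of $\acute{M}$ and $U=-\varphi N$, one takes $D^{\perp}=\mathrm{span}\{U,\xi\}$ and $D$ its orthogonal complement in $T\acute{M}$. $\acute g$ is the induced metric, $\acute\nabla$ its Levi-Civita connection, and $A$ is the shape operator with respect to $N$: $AX=-\nabla_XN$, where $\nabla$ is the Levi-Civita connection of $g$. $A$ is parallel if $\acute\nabla_X A=0$ for all $X\in T\acute{M}$. Totally umbilic means that $A=\mu\,\mathrm{Id}$ for some function $\mu$ on $\acute M$. *)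

theory Defs
  imports "HOL-Analysis.Analysis" "HOL-Library.Function_Algebras"
begin

instantiation "fun" :: (type, real_vector) real_vector
begin

definition scaleR_fun :: "real \<Rightarrow> ('a \<Rightarrow> 'b) \<Rightarrow> 'a \<Rightarrow> 'b"
  where "scaleR_fun a v = (\<lambda>x. a *\<^sub>R v x)"

instance
  by standard (auto simp: scaleR_fun_def fun_eq_iff scaleR_add_right scaleR_add_left)

end

text \<open>\<open>C\<^sup>k\<close> on an open subset of a Euclidean space, by recursion over directional derivatives.\<close>

fun Ck_on :: "nat \<Rightarrow> 'a::euclidean_space set \<Rightarrow> ('a \<Rightarrow> 'b::real_normed_vector) \<Rightarrow> bool" where
  "Ck_on 0 S f \<longleftrightarrow> continuous_on S f"
| "Ck_on (Suc k) S f \<longleftrightarrow> (\<forall>x\<in>S. f differentiable (at x)) \<and>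
     (\<forall>v. Ck_on k S (\<lambda>x. frechet_derivative f (at x) v))"

definition smooth_on :: "'a::euclidean_space set \<Rightarrow> ('a \<Rightarrow> 'b::real_normed_vector) \<Rightarrow> bool"
  where "smooth_on S f \<longleftrightarrow> (\<forall>k. Ck_on k S f)"

text \<open>A chart is a pair \<open>(U, x)\<close>; the values of \<open>x\<close> outside \<open>U\<close> are irrelevant.\<close>

type_synonym ('m, 'e) chart = "'m set \<times> ('m \<Rightarrow> 'e)"

record ('m, 'e) manifold =
  mtop :: "'m topology"
  atlas :: "('m, 'e) chart set"

abbreviation points :: "('m, 'e) manifold \<Rightarrow> 'm set"
  where "points M \<equiv> topspace (mtop M)"

definition is_chart :: "'m topology \<Rightarrow> ('m, 'e::euclidean_space) chart \<Rightarrow> bool"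
  where "is_chart T c \<longleftrightarrow> (case c of (U, x) \<Rightarrow>
     openin T U \<and> open (x ` U) \<and>
     homeomorphic_map (subtopology T U) (top_of_set (x ` U)) x)"

definition smooth_transition :: "('m, 'e::euclidean_space) chart \<Rightarrow> ('m, 'e) chart \<Rightarrow> bool"
  where "smooth_transition c d \<longleftrightarrow> (case c of (U, x) \<Rightarrow> case d of (V, y) \<Rightarrow>
     smooth_on (x ` (U \<inter> V)) (y \<circ> inv_into U x))"

definition smooth_manifold :: "('m, 'e::euclidean_space) manifold \<Rightarrow> bool"
  where "smooth_manifold M \<longleftrightarrow>
     Hausdorff_space (mtop M) \<and> second_countable (mtop M) \<and>
     (\<forall>c\<in>atlas M. is_chart (mtop M) c) \<and>
     (\<Union>c\<in>atlas M. fst c) = points M \<and>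
     (\<forall>c\<in>atlas M. \<forall>d\<in>atlas M. smooth_transition c d) \<and>
     (\<forall>c. is_chart (mtop M) c \<and>
        (\<forall>d\<in>atlas M. smooth_transition c d \<and> smooth_transition d c) \<longrightarrow> c \<in> atlas M)"

definition smooth_fun :: "('m, 'e::euclidean_space) manifold \<Rightarrow> 'm set \<Rightarrow> ('m \<Rightarrow> real) \<Rightarrow> bool"
  where "smooth_fun M W h \<longleftrightarrow> openin (mtop M) W \<and>
     (\<forall>(U, x)\<in>atlas M. smooth_on (x ` (U \<inter> W)) (h \<circ> inv_into U x))"

definition smooth_near :: "('m, 'e::euclidean_space) manifold \<Rightarrow> 'm \<Rightarrow> ('m \<Rightarrow> real) \<Rightarrow> bool"
  where "smooth_near M p h \<longleftrightarrow> (\<exists>W. p \<in> W \<and> smooth_fun M W h)"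

text \<open>
  A tangent vector at \<open>p\<close> is a derivation of the algebra of germs of smooth functions at \<open>p\<close>,
  extended by 0 to the functions that are not smooth near \<open>p\<close> so that it is determined by its
  values on germs.
\<close>

type_synonym 'm tvec = "('m \<Rightarrow> real) \<Rightarrow> real"

definition tangent_space :: "('m, 'e::euclidean_space) manifold \<Rightarrow> 'm \<Rightarrow> 'm tvec set"
  where "tangent_space M p = {v.
     (\<forall>h k. smooth_near M p h \<and> smooth_near M p k \<longrightarrow>
        v (\<lambda>q. h q + k q) = v h + v k \<and>
        v (\<lambda>q. h q * k q) = v h * k p + h p * v k) \<and>
     (\<forall>a h. smooth_near M p h \<longrightarrow> v (\<lambda>q. a * h q) = a * v h) \<and>
     (\<forall>h k W. smooth_near M p h \<and> smooth_near M p k \<and> openin (mtop M) W \<and> p \<in> W \<and>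
        (\<forall>q\<in>W. h q = k q) \<longrightarrow> v h = v k) \<and>
     (\<forall>h. \<not> smooth_near M p h \<longrightarrow> v h = 0)}"

type_synonym 'm vfield = "'m \<Rightarrow> 'm tvec"

text \<open>Vector fields are only considered locally, on open sets \<open>W\<close>.\<close>

definition smooth_vfield :: "('m, 'e::euclidean_space) manifold \<Rightarrow> 'm set \<Rightarrow> 'm vfield \<Rightarrow> bool"
  where "smooth_vfield M W X \<longleftrightarrow> openin (mtop M) W \<and>
     (\<forall>p\<in>W. X p \<in> tangent_space M p) \<and>
     (\<forall>V h. V \<subseteq> W \<and> smooth_fun M V h \<longrightarrow> smooth_fun M V (\<lambda>p. X p h))"

definition lie_bracket :: "('m, 'e::euclidean_space) manifold \<Rightarrow> 'm vfield \<Rightarrow> 'm vfield \<Rightarrow> 'm vfield"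
  where "lie_bracket M X Y p =
     (\<lambda>h. if smooth_near M p h then X p (\<lambda>q. Y q h) - Y p (\<lambda>q. X q h) else 0)"

definition smooth_endomorphism ::
    "('m, 'e::euclidean_space) manifold \<Rightarrow> ('m \<Rightarrow> 'm tvec \<Rightarrow> 'm tvec) \<Rightarrow> bool"
  where "smooth_endomorphism M \<phi> \<longleftrightarrow>
     (\<forall>p\<in>points M. \<forall>v\<in>tangent_space M p. \<phi> p v \<in> tangent_space M p) \<and>
     (\<forall>p\<in>points M. \<forall>v\<in>tangent_space M p. \<forall>w\<in>tangent_space M p. \<forall>a b.
        \<phi> p (a *\<^sub>R v + b *\<^sub>R w) = a *\<^sub>R \<phi> p v + b *\<^sub>R \<phi> p w) \<and>
     (\<forall>W X. smooth_vfield M W X \<longrightarrow> smooth_vfield M W (\<lambda>p. \<phi> p (X p)))"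

definition smooth_one_form ::
    "('m, 'e::euclidean_space) manifold \<Rightarrow> ('m \<Rightarrow> 'm tvec \<Rightarrow> real) \<Rightarrow> bool"
  where "smooth_one_form M \<eta> \<longleftrightarrow>
     (\<forall>p\<in>points M. \<forall>v\<in>tangent_space M p. \<forall>w\<in>tangent_space M p. \<forall>a b.
        \<eta> p (a *\<^sub>R v + b *\<^sub>R w) = a * \<eta> p v + b * \<eta> p w) \<and>
     (\<forall>W X. smooth_vfield M W X \<longrightarrow> smooth_fun M W (\<lambda>p. \<eta> p (X p)))"

definition riemannian_metric ::
    "('m, 'e::euclidean_space) manifold \<Rightarrow> ('m \<Rightarrow> 'm tvec \<Rightarrow> 'm tvec \<Rightarrow> real) \<Rightarrow> bool"
  where "riemannian_metric M g \<longleftrightarrow>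
     (\<forall>p\<in>points M. \<forall>u\<in>tangent_space M p. \<forall>v\<in>tangent_space M p. \<forall>w\<in>tangent_space M p. \<forall>a b.
        g p (a *\<^sub>R u + b *\<^sub>R v) w = a * g p u w + b * g p v w) \<and>
     (\<forall>p\<in>points M. \<forall>v\<in>tangent_space M p. \<forall>w\<in>tangent_space M p. g p v w = g p w v) \<and>
     (\<forall>p\<in>points M. \<forall>v\<in>tangent_space M p. v \<noteq> 0 \<longrightarrow> g p v v > 0) \<and>
     (\<forall>W X Y. smooth_vfield M W X \<and> smooth_vfield M W Y \<longrightarrow>
        smooth_fun M W (\<lambda>p. g p (X p) (Y p)))"

text \<open>
  \<open>nabla p v Y\<close> is the covariant derivative at \<open>p\<close> of the vector field \<open>Y\<close>, defined near \<open>p\<close>,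
  in the direction \<open>v\<close>; so \<open>\<nabla>\<^sub>X Y\<close> is \<open>\<lambda>p. nabla p (X p) Y\<close>.
\<close>

type_synonym 'm conn = "'m \<Rightarrow> 'm tvec \<Rightarrow> 'm vfield \<Rightarrow> 'm tvec"

definition affine_connection :: "('m, 'e::euclidean_space) manifold \<Rightarrow> 'm conn \<Rightarrow> bool"
  where "affine_connection M nabla \<longleftrightarrow>
     (\<forall>W Y p. smooth_vfield M W Y \<and> p \<in> W \<longrightarrow>
        (\<forall>v\<in>tangent_space M p. nabla p v Y \<in> tangent_space M p) \<and>
        (\<forall>v\<in>tangent_space M p. \<forall>w\<in>tangent_space M p. \<forall>a b.
           nabla p (a *\<^sub>R v + b *\<^sub>R w) Y = a *\<^sub>R nabla p v Y + b *\<^sub>R nabla p w Y)) \<and>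
     (\<forall>W Y Z p. smooth_vfield M W Y \<and> smooth_vfield M W Z \<and> p \<in> W \<longrightarrow>
        (\<forall>v\<in>tangent_space M p. nabla p v (\<lambda>q. Y q + Z q) = nabla p v Y + nabla p v Z)) \<and>
     (\<forall>W Y h p. smooth_vfield M W Y \<and> smooth_fun M W h \<and> p \<in> W \<longrightarrow>
        (\<forall>v\<in>tangent_space M p.
           nabla p v (\<lambda>q. h q *\<^sub>R Y q) = v h *\<^sub>R Y p + h p *\<^sub>R nabla p v Y)) \<and>
     (\<forall>W Y Z p. smooth_vfield M W Y \<and> smooth_vfield M W Z \<and> p \<in> W \<and> (\<forall>q\<in>W. Y q = Z q) \<longrightarrow>
        (\<forall>v\<in>tangent_space M p. nabla p v Y = nabla p v Z)) \<and>
     (\<forall>W X Y. smooth_vfield M W X \<and> smooth_vfield M W Y \<longrightarrow>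
        smooth_vfield M W (\<lambda>p. nabla p (X p) Y))"

definition levi_civita ::
    "('m, 'e::euclidean_space) manifold \<Rightarrow> ('m \<Rightarrow> 'm tvec \<Rightarrow> 'm tvec \<Rightarrow> real) \<Rightarrow> 'm conn \<Rightarrow> bool"
  where "levi_civita M g nabla \<longleftrightarrow> affine_connection M nabla \<and>
     (\<forall>W X Y p. smooth_vfield M W X \<and> smooth_vfield M W Y \<and> p \<in> W \<longrightarrow>
        nabla p (X p) Y - nabla p (Y p) X = lie_bracket M X Y p) \<and>
     (\<forall>W Y Z p. smooth_vfield M W Y \<and> smooth_vfield M W Z \<and> p \<in> W \<longrightarrow>
        (\<forall>v\<in>tangent_space M p.
           v (\<lambda>q. g q (Y q) (Z q)) = g p (nabla p v Y) (Z p) + g p (Y p) (nabla p v Z)))"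

definition curvature ::
    "('m, 'e::euclidean_space) manifold \<Rightarrow> 'm conn \<Rightarrow> 'm vfield \<Rightarrow> 'm vfield \<Rightarrow> 'm vfield \<Rightarrow> 'm vfield"
  where "curvature M nabla X Y Z p =
     nabla p (X p) (\<lambda>q. nabla q (Y q) Z) - nabla p (Y p) (\<lambda>q. nabla q (X q) Z)
     - nabla p (lie_bracket M X Y p) Z"

text \<open>For the Levi-Civita connection this depends on the values of the fields at \<open>p\<close> only.\<close>

definition sectional_curvature ::
    "('m, 'e::euclidean_space) manifold \<Rightarrow> ('m \<Rightarrow> 'm tvec \<Rightarrow> 'm tvec \<Rightarrow> real) \<Rightarrow> 'm conn \<Rightarrow>
     'm vfield \<Rightarrow> 'm vfield \<Rightarrow> 'm \<Rightarrow> real"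
  where "sectional_curvature M g nabla X Y p =
     g p (curvature M nabla X Y Y p) (X p) /
     (g p (X p) (X p) * g p (Y p) (Y p) - (g p (X p) (Y p))\<^sup>2)"

definition almost_contact_metric ::
    "('m, 'e::euclidean_space) manifold \<Rightarrow> ('m \<Rightarrow> 'm tvec \<Rightarrow> 'm tvec) \<Rightarrow> 'm vfield \<Rightarrow>
     ('m \<Rightarrow> 'm tvec \<Rightarrow> real) \<Rightarrow> ('m \<Rightarrow> 'm tvec \<Rightarrow> 'm tvec \<Rightarrow> real) \<Rightarrow> bool"
  where "almost_contact_metric M \<phi> \<xi> \<eta> g \<longleftrightarrow>
     smooth_manifold M \<and> odd DIM('e) \<and>
     smooth_endomorphism M \<phi> \<and> smooth_vfield M (points M) \<xi> \<and>
     smooth_one_form M \<eta> \<and> riemannian_metric M g \<and>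
     (\<forall>p\<in>points M.
        \<eta> p (\<xi> p) = 1 \<and> \<phi> p (\<xi> p) = 0 \<and>
        (\<forall>v\<in>tangent_space M p.
           \<phi> p (\<phi> p v) = - v + \<eta> p v *\<^sub>R \<xi> p \<and>
           \<eta> p (\<phi> p v) = 0 \<and>
           \<eta> p v = g p v (\<xi> p) \<and>
           (\<forall>w\<in>tangent_space M p. g p (\<phi> p v) (\<phi> p w) = g p v w - \<eta> p v * \<eta> p w)))"

text \<open>
  The Levi-Civita connection of a metric exists and is unique (on the arguments that matter), so
  the existential quantifiers over \<open>nabla\<close> below just name it.
\<close>

definition kenmotsu ::
    "('m, 'e::euclidean_space) manifold \<Rightarrow> ('m \<Rightarrow> 'm tvec \<Rightarrow> 'm tvec) \<Rightarrow> 'm vfield \<Rightarrow>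
     ('m \<Rightarrow> 'm tvec \<Rightarrow> real) \<Rightarrow> ('m \<Rightarrow> 'm tvec \<Rightarrow> 'm tvec \<Rightarrow> real) \<Rightarrow> bool"
  where "kenmotsu M \<phi> \<xi> \<eta> g \<longleftrightarrow> almost_contact_metric M \<phi> \<xi> \<eta> g \<and>
     (\<exists>nabla. levi_civita M g nabla \<and>
        (\<forall>W Y p. smooth_vfield M W Y \<and> p \<in> W \<longrightarrow>
           (\<forall>v\<in>tangent_space M p.
              nabla p v (\<lambda>q. \<phi> q (Y q)) - \<phi> p (nabla p v Y) =
              - g p v (\<phi> p (Y p)) *\<^sub>R \<xi> p - \<eta> p (Y p) *\<^sub>R \<phi> p v)))"

definition constant_phi_sectional_curvature ::
    "('m, 'e::euclidean_space) manifold \<Rightarrow> ('m \<Rightarrow> 'm tvec \<Rightarrow> 'm tvec) \<Rightarrow> 'm vfield \<Rightarrow>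
     ('m \<Rightarrow> 'm tvec \<Rightarrow> 'm tvec \<Rightarrow> real) \<Rightarrow> real \<Rightarrow> bool"
  where "constant_phi_sectional_curvature M \<phi> \<xi> g c \<longleftrightarrow>
     (\<exists>nabla. levi_civita M g nabla \<and>
        (\<forall>W X p. smooth_vfield M W X \<and> p \<in> W \<and> X p \<noteq> 0 \<and> g p (X p) (\<xi> p) = 0 \<longrightarrow>
           sectional_curvature M g nabla X (\<lambda>q. \<phi> q (X q)) p = c))"

definition conformal_kenmotsu ::
    "('m, 'e::euclidean_space) manifold \<Rightarrow> ('m \<Rightarrow> 'm tvec \<Rightarrow> 'm tvec) \<Rightarrow> 'm vfield \<Rightarrow>
     ('m \<Rightarrow> 'm tvec \<Rightarrow> real) \<Rightarrow> ('m \<Rightarrow> 'm tvec \<Rightarrow> 'm tvec \<Rightarrow> real) \<Rightarrow> ('m \<Rightarrow> real) \<Rightarrow> bool"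
  where "conformal_kenmotsu M \<phi> \<xi> \<eta> g f \<longleftrightarrow>
     almost_contact_metric M \<phi> \<xi> \<eta> g \<and>
     smooth_fun M (points M) f \<and> (\<forall>p\<in>points M. f p > 0) \<and>
     kenmotsu M \<phi> (\<lambda>p. exp (- f p / 2) *\<^sub>R \<xi> p) (\<lambda>p v. exp (f p / 2) * \<eta> p v)
       (\<lambda>p v w. exp (f p) * g p v w)"

definition conformal_kenmotsu_space_form ::
    "('m, 'e::euclidean_space) manifold \<Rightarrow> ('m \<Rightarrow> 'm tvec \<Rightarrow> 'm tvec) \<Rightarrow> 'm vfield \<Rightarrow>
     ('m \<Rightarrow> 'm tvec \<Rightarrow> real) \<Rightarrow> ('m \<Rightarrow> 'm tvec \<Rightarrow> 'm tvec \<Rightarrow> real) \<Rightarrow> ('m \<Rightarrow> real) \<Rightarrow> real \<Rightarrow> bool"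
  where "conformal_kenmotsu_space_form M \<phi> \<xi> \<eta> g f c \<longleftrightarrow>
     conformal_kenmotsu M \<phi> \<xi> \<eta> g f \<and>
     constant_phi_sectional_curvature M \<phi> (\<lambda>p. exp (- f p / 2) *\<^sub>R \<xi> p)
       (\<lambda>p v w. exp (f p) * g p v w) c"

definition lee_form :: "('m \<Rightarrow> real) \<Rightarrow> 'm \<Rightarrow> 'm tvec \<Rightarrow> real"
  where "lee_form f p v = v f"

text \<open>\<open>B\<close> is the vector field metrically dual to the 1-form \<open>\<omega>\<close>.\<close>

definition is_sharp ::
    "('m, 'e::euclidean_space) manifold \<Rightarrow> ('m \<Rightarrow> 'm tvec \<Rightarrow> 'm tvec \<Rightarrow> real) \<Rightarrow>
     ('m \<Rightarrow> 'm tvec \<Rightarrow> real) \<Rightarrow> 'm vfield \<Rightarrow> bool"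
  where "is_sharp M g \<omega> B \<longleftrightarrow> (\<forall>p\<in>points M. B p \<in> tangent_space M p \<and>
     (\<forall>v\<in>tangent_space M p. g p (B p) v = \<omega> p v))"

text \<open>
  \<open>S\<close> carries the subspace topology and is locally cut out in a chart of \<open>M\<close> by a linear subspace
  \<open>range L\<close> of the model space; the smooth structure of \<open>S\<close> is the one given by the restrictions of
  these slice charts.
\<close>

definition embedded_submanifold ::
    "('m, 'e::euclidean_space) manifold \<Rightarrow> ('m, 'f::euclidean_space) manifold \<Rightarrow> bool"
  where "embedded_submanifold M S \<longleftrightarrow>
     smooth_manifold M \<and> smooth_manifold S \<and>
     points S \<subseteq> points M \<and> mtop S = subtopology (mtop M) (points S) \<and>
     (\<forall>p\<in>points S. \<exists>U x y L. (U, x) \<in> atlas M \<and> p \<in> U \<and> (U \<inter> points S, y) \<in> atlas S \<and>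
        linear (L :: 'f \<Rightarrow> 'e) \<and> inj L \<and>
        x ` (U \<inter> points S) = x ` U \<inter> range L \<and> (\<forall>q\<in>U \<inter> points S. x q = L (y q)))"

text \<open>
  The differential at \<open>p\<close> of the inclusion of a submanifold: \<open>v\<close> applied to the restriction of a
  function that is smooth near \<open>p\<close> in \<open>M\<close>.
\<close>

definition push :: "('m, 'e::euclidean_space) manifold \<Rightarrow> 'm \<Rightarrow> 'm tvec \<Rightarrow> 'm tvec"
  where "push M p v = (\<lambda>h. if smooth_near M p h then v h else 0)"

definition tangent_in ::
    "('m, 'e::euclidean_space) manifold \<Rightarrow> ('m, 'f::euclidean_space) manifold \<Rightarrow> 'm \<Rightarrow> 'm tvec set"
  where "tangent_in M S p = push M p ` tangent_space S p"

definition normal_space ::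
    "('m, 'e::euclidean_space) manifold \<Rightarrow> ('m, 'f::euclidean_space) manifold \<Rightarrow>
     ('m \<Rightarrow> 'm tvec \<Rightarrow> 'm tvec \<Rightarrow> real) \<Rightarrow> 'm \<Rightarrow> 'm tvec set"
  where "normal_space M S g p =
     {w \<in> tangent_space M p. \<forall>v\<in>tangent_in M S p. g p w v = 0}"

definition induced_metric ::
    "('m, 'e::euclidean_space) manifold \<Rightarrow> ('m \<Rightarrow> 'm tvec \<Rightarrow> 'm tvec \<Rightarrow> real) \<Rightarrow>
     'm \<Rightarrow> 'm tvec \<Rightarrow> 'm tvec \<Rightarrow> real"
  where "induced_metric M g p v w = g p (push M p v) (push M p w)"

text \<open>A smooth distribution of rank \<open>k\<close> on \<open>S\<close>, its fibres regarded as subspaces of \<open>T\<^sub>p M\<close>.\<close>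

definition distribution ::
    "('m, 'e::euclidean_space) manifold \<Rightarrow> ('m, 'f::euclidean_space) manifold \<Rightarrow> nat \<Rightarrow>
     ('m \<Rightarrow> 'm tvec set) \<Rightarrow> bool"
  where "distribution M S k D \<longleftrightarrow> (\<forall>p\<in>points S. \<exists>W X. openin (mtop S) W \<and> p \<in> W \<and>
     (\<forall>i<k. smooth_vfield S W (X i)) \<and>
     (\<forall>q\<in>W. D q = span ((\<lambda>i. push M q (X i q)) ` {..<k}) \<and> dim (D q) = k))"

definition cr_hypersurface ::
    "('m, 'e::euclidean_space) manifold \<Rightarrow> ('m, 'f::euclidean_space) manifold \<Rightarrow>
     ('m \<Rightarrow> 'm tvec \<Rightarrow> 'm tvec) \<Rightarrow> 'm vfield \<Rightarrow> ('m \<Rightarrow> 'm tvec \<Rightarrow> 'm tvec \<Rightarrow> real) \<Rightarrow>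
     ('m \<Rightarrow> 'm tvec set) \<Rightarrow> ('m \<Rightarrow> 'm tvec set) \<Rightarrow> bool"
  where "cr_hypersurface M S \<phi> \<xi> g D Dp \<longleftrightarrow>
     embedded_submanifold M S \<and> DIM('e) = DIM('f) + 1 \<and>
     (\<exists>k. distribution M S k D) \<and> (\<exists>k. distribution M S k Dp) \<and>
     (\<forall>p\<in>points S.
        \<xi> p \<in> tangent_in M S p \<and>
        tangent_in M S p = {v + w |v w. v \<in> D p \<and> w \<in> Dp p} \<and> D p \<inter> Dp p = {0} \<and>
        (\<forall>v\<in>D p. \<forall>w\<in>Dp p. g p v w = 0) \<and>
        \<phi> p ` D p \<subseteq> D p \<and>
        \<phi> p ` Dp p \<subseteq> normal_space M S g p)"

text \<open>
  For a submanifold, smoothness of a section along \<open>S\<close> amounts to the existence of smooth local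
  extensions to \<open>M\<close>.
\<close>

definition local_extension ::
    "('m, 'e::euclidean_space) manifold \<Rightarrow> ('m, 'f::euclidean_space) manifold \<Rightarrow>
     'm vfield \<Rightarrow> 'm \<Rightarrow> 'm vfield \<Rightarrow> bool"
  where "local_extension M S N p Z \<longleftrightarrow>
     (\<exists>W. smooth_vfield M W Z \<and> p \<in> W \<and> (\<forall>q\<in>W \<inter> points S. Z q = N q))"

definition unit_normal_field ::
    "('m, 'e::euclidean_space) manifold \<Rightarrow> ('m, 'f::euclidean_space) manifold \<Rightarrow>
     ('m \<Rightarrow> 'm tvec \<Rightarrow> 'm tvec \<Rightarrow> real) \<Rightarrow> 'm vfield \<Rightarrow> bool"
  where "unit_normal_field M S g N \<longleftrightarrow>
     (\<forall>p\<in>points S. N p \<in> normal_space M S g p \<and> g p (N p) (N p) = 1 \<and>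
        (\<exists>Z. local_extension M S N p Z))"

text \<open>\<open>A X = - \<nabla>\<^sub>X N\<close>, where \<open>N\<close> is extended locally to \<open>M\<close> in any way.\<close>

definition shape_operator ::
    "('m, 'e::euclidean_space) manifold \<Rightarrow> ('m, 'f::euclidean_space) manifold \<Rightarrow> 'm conn \<Rightarrow>
     'm vfield \<Rightarrow> ('m \<Rightarrow> 'm tvec \<Rightarrow> 'm tvec) \<Rightarrow> bool"
  where "shape_operator M S nabla N A \<longleftrightarrow>
     (\<forall>p\<in>points S. \<forall>v\<in>tangent_space S p. A p v \<in> tangent_space S p \<and>
        (\<forall>Z. local_extension M S N p Z \<longrightarrow> push M p (A p v) = - nabla p (push M p v) Z))"

definition parallel_endomorphism ::
    "('m, 'f::euclidean_space) manifold \<Rightarrow> 'm conn \<Rightarrow> ('m \<Rightarrow> 'm tvec \<Rightarrow> 'm tvec) \<Rightarrow> bool"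
  where "parallel_endomorphism S nabla A \<longleftrightarrow>
     (\<forall>W Y p. smooth_vfield S W Y \<and> p \<in> W \<longrightarrow>
        (\<forall>v\<in>tangent_space S p. nabla p v (\<lambda>q. A q (Y q)) - A p (nabla p v Y) = 0))"

definition totally_umbilic ::
    "('m, 'f::euclidean_space) manifold \<Rightarrow> ('m \<Rightarrow> 'm tvec \<Rightarrow> 'm tvec) \<Rightarrow> bool"
  where "totally_umbilic S A \<longleftrightarrow>
     (\<exists>\<mu> :: 'm \<Rightarrow> real. \<forall>p\<in>points S. \<forall>v\<in>tangent_space S p. A p v = \<mu> p *\<^sub>R v)"

end

theory Submission
  imports Defs
begin

text \<open>
  The Kenmotsu condition for \<open>e\<^sup>f g\<close> gives the covariant derivative of its Reeb field, and
  the Koszul formula turns this into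
  \<open>\<nabla>\<^sub>X \<xi> = e\<^bsup>f/2\<^esup> (X - \<eta>(X) \<xi>) + \<eta>(X) N / 2\<close> for \<open>X\<close> tangent to \<open>S\<close>,
  because \<open>grad f = N\<close> along \<open>S\<close>. The normal part together with the symmetry of \<open>A\<close> yields
  \<open>A \<xi> = \<xi> / 2\<close>. Differentiating this along \<open>S\<close> with \<open>A\<close> parallel shows that \<open>A\<close> acts as
  \<open>1/2\<close> on the tangential part \<open>e\<^bsup>f/2\<^esup> (X - \<eta>(X) \<xi>)\<close> as well, so \<open>A = Id / 2\<close>. To work with
  germs, Hadamard's lemma identifies derivations with coordinate directional derivatives; this
  provides local vector fields with prescribed values, also tangent to \<open>S\<close> along \<open>S\<close>.
\<close>

subsection \<open>Functions of class \<open>C\<^sup>k\<close> and Hadamard's lemma\<close>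

text \<open>The constant 1/2 has a single source. Passing from g to e^f g adds derivatives of f to
  the Koszul expression, and for tangent X the only one surviving in g(nabla_X \<xi>, N) is N(f)
  \<eta>(X) / 2, where N(f) = g(N, N) = 1. The symmetry of A enters as the tangency of brackets: for
  Y tangent to S, nabla_\<xi> Y and nabla_Y \<xi> have the same normal component. The last step
  reaches every direction because the tangential part of nabla_X \<xi> is a nonzero multiple of X
  modulo \<xi>, and A is already known on \<xi>.

  The obstacle is the passage between M and S. Connections act on fields over open sets, and tangent
  vectors of S and of M are derivations of different algebras, linked only by \<open>push\<close>.
  The Koszul expression contains a metric and brackets but no connection, so it can be compared term
  by term, both between g and e^f g and between M and S, for fields related by the
  inclusion.\<close>

lemma Ck_on_cong:
  assumes "open S" "\<And>x. x \<in> S \<Longrightarrow> f x = g x" "Ck_on k S f"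
  shows "Ck_on k S g"
  using assms(2,3)
proof (induction k arbitrary: f g)
  case 0
  then show ?case by (auto cong: continuous_on_cong)
next
  case (Suc k)
  have d: "f differentiable at x" if "x \<in> S" for x
    using Suc.prems(2) that by auto
  have "g differentiable at x" if "x \<in> S" for x
    using d[OF that] has_derivative_transform_within_open[OF _ assms(1) that] Suc.prems(1)
    unfolding differentiable_def by metis
  moreover have "Ck_on k S (\<lambda>x. frechet_derivative g (at x) v)" for v
  proof (rule Suc.IH[of "\<lambda>x. frechet_derivative f (at x) v"])
    show "frechet_derivative f (at x) v = frechet_derivative g (at x) v" if "x \<in> S" for x
      using frechet_derivative_transform_within_open[OF d[OF that] assms(1) that] Suc.prems(1)
      by metis
    show "Ck_on k S (\<lambda>x. frechet_derivative f (at x) v)"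
      using Suc.prems(2) by simp
  qed
  ultimately show ?case by simp
qed

text \<open>Derivatives on an open set are unique, so the chosen \<open>frechet_derivative\<close>
  in the recursion may be replaced by any explicit formula \<open>f'\<close>. This reduces closure
  properties to differentiation rules.\<close>

lemma Ck_on_SucI:
  assumes "open S" "\<And>x. x \<in> S \<Longrightarrow> (f has_derivative f' x) (at x)"
    and "\<And>v. Ck_on k S (\<lambda>x. f' x v)"
  shows "Ck_on (Suc k) S f"
proof -
  have "Ck_on k S (\<lambda>x. frechet_derivative f (at x) v)" for v
    by (rule Ck_on_cong[OF assms(1) _ assms(3)[of v]])
      (use assms(2) frechet_derivative_at in metis)
  then show ?thesis using assms(2) by (auto simp: differentiable_def)
qed

lemma Ck_on_Suc_has_derivative:
  assumes "Ck_on (Suc k) S f" "x \<in> S"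
  shows "(f has_derivative frechet_derivative f (at x)) (at x)"
  using assms frechet_derivative_works by auto

lemma Ck_on_SucD: "Ck_on (Suc k) S f \<Longrightarrow> Ck_on k S f"
proof (induction k arbitrary: f)
  case 0
  then show ?case
    by (auto intro!: differentiable_imp_continuous_within continuous_at_imp_continuous_on)
next
  case (Suc k)
  from Suc.prems show ?case using Suc.IH by simp
qed

lemma Ck_on_subset: "Ck_on k S f \<Longrightarrow> T \<subseteq> S \<Longrightarrow> Ck_on k T f"
  by (induction k arbitrary: f) (auto intro: continuous_on_subset)

lemma Ck_on_local:
  assumes "\<And>x. x \<in> S \<Longrightarrow> \<exists>T. open T \<and> x \<in> T \<and> Ck_on k T f"
  shows "Ck_on k S f"
  using assms
proof (induction k arbitrary: f)
  case 0
  then show ?case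
    by (metis Ck_on.simps(1) continuous_at_imp_continuous_on continuous_on_eq_continuous_at)
next
  case (Suc k)
  have "f differentiable at x" if "x \<in> S" for x
    using Suc.prems[OF that] by auto
  moreover have "Ck_on k S (\<lambda>x. frechet_derivative f (at x) v)" for v
    by (rule Suc.IH) (use Suc.prems in fastforce)
  ultimately show ?case by simp
qed

lemma Ck_on_const: "Ck_on k S (\<lambda>x. c)"
  by (induction k arbitrary: c) auto

lemma Ck_on_linear:
  assumes "open S" "bounded_linear L"
  shows "Ck_on k S L"
proof (cases k)
  case 0
  then show ?thesis using assms by (simp add: linear_continuous_on)
next
  case (Suc j)
  then show ?thesis
    by (auto intro!: Ck_on_SucI[OF assms(1)] bounded_linear_imp_has_derivative[OF assms(2)] Ck_on_const
        simp del: Ck_on.simps)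
qed

lemma Ck_on_add:
  assumes "open S" "Ck_on k S f" "Ck_on k S g"
  shows "Ck_on k S (\<lambda>x. f x + g x)"
  using assms(2,3)
proof (induction k arbitrary: f g)
  case 0
  then show ?case by (auto intro: continuous_intros)
next
  case (Suc k)
  note d = Suc.prems[THEN Ck_on_Suc_has_derivative]
  show ?case
    by (rule Ck_on_SucI[OF assms(1) has_derivative_add[OF d]])
      (use Suc in \<open>auto intro!: Suc.IH\<close>)
qed

lemma Ck_on_sum:
  assumes "open S" "\<And>i. i \<in> I \<Longrightarrow> Ck_on k S (f i)"
  shows "Ck_on k S (\<lambda>x. \<Sum>i\<in>I. f i x)"
  using assms(2)
  by (induction I rule: infinite_finite_induct) (auto intro: Ck_on_const Ck_on_add[OF assms(1)])

lemma Ck_on_bilinear: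
  assumes "bounded_bilinear B" "open S" "Ck_on k S f" "Ck_on k S g"
  shows "Ck_on k S (\<lambda>x. B (f x) (g x))"
  using assms(3,4)
proof (induction k arbitrary: f g)
  case 0
  then show ?case by (auto intro: bounded_bilinear.continuous_on[OF assms(1)])
next
  case (Suc k)
  note d = Suc.prems[THEN Ck_on_Suc_has_derivative]
  show ?case
    by (rule Ck_on_SucI[OF assms(2) bounded_bilinear.FDERIV[OF assms(1) d]])
      (use Suc.prems Suc.prems[THEN Ck_on_SucD] in \<open>auto intro!: Suc.IH Ck_on_add[OF assms(2)]\<close>)
qed

lemmas Ck_on_mult = Ck_on_bilinear[OF bounded_bilinear_mult]
lemmas Ck_on_scaleR = Ck_on_bilinear[OF bounded_bilinear_scaleR]
lemmas Ck_on_inner = Ck_on_bilinear[OF bounded_bilinear_inner]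

lemma linear_sum_Basis:
  fixes L :: "'a::euclidean_space \<Rightarrow> 'b::real_vector"
  assumes "linear L"
  shows "L v = (\<Sum>b\<in>Basis. (v \<bullet> b) *\<^sub>R L b)"
proof -
  have "L v = L (\<Sum>b\<in>Basis. (v \<bullet> b) *\<^sub>R b)" by (simp add: euclidean_representation)
  also have "\<dots> = (\<Sum>b\<in>Basis. (v \<bullet> b) *\<^sub>R L b)"
    by (simp only: linear_sum[OF assms] linear_scale[OF assms] o_def)
  finally show ?thesis .
qed

text \<open>The direction \<open>frechet_derivative f (at x) v\<close> in which \<open>g\<close> is
  differentiated varies with \<open>x\<close>, while the recursion controls fixed directions only.
  Expanding it in \<open>Basis\<close> leaves finitely many products of a scalar coefficient with a
  derivative of \<open>g\<close> in a fixed direction, composed with \<open>f\<close>.\<close>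

lemma Ck_on_compose:
  fixes f :: "'a::euclidean_space \<Rightarrow> 'b::euclidean_space"
    and g :: "'b \<Rightarrow> 'c::real_normed_vector"
  assumes "open S" "open T" "f ` S \<subseteq> T" "Ck_on k S f" "Ck_on k T g"
  shows "Ck_on k S (g \<circ> f)"
  using assms(4,5)
proof (induction k arbitrary: g)
  case 0
  then show ?case using assms(3) by (auto simp: o_def intro: continuous_on_compose2)
next
  case (Suc k)
  note df = Ck_on_Suc_has_derivative[OF Suc.prems(1)]
  have dg: "(g has_derivative frechet_derivative g (at (f x))) (at (f x))" if "x \<in> S" for x
    using Ck_on_Suc_has_derivative[OF Suc.prems(2)] assms(3) that by blast
  have eq: "frechet_derivative g (at (f x)) v =
      (\<Sum>b\<in>Basis. (v \<bullet> b) *\<^sub>R frechet_derivative g (at (f x)) b)" if "x \<in> S" for x v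
    using linear_sum_Basis has_derivative_linear[OF dg[OF that]] by blast
  have "((g \<circ> f) has_derivative (\<lambda>v. \<Sum>b\<in>Basis.
      (frechet_derivative f (at x) v \<bullet> b) *\<^sub>R (frechet_derivative g (at (f x)) b))) (at x)"
    if "x \<in> S" for x
  proof (rule has_derivative_eq_rhs[OF diff_chain_at[OF df[OF that] dg[OF that]]])
    show "frechet_derivative g (at (f x)) \<circ> frechet_derivative f (at x) = (\<lambda>v. \<Sum>b\<in>Basis.
        (frechet_derivative f (at x) v \<bullet> b) *\<^sub>R (frechet_derivative g (at (f x)) b))"
      unfolding o_def by (rule ext) (rule eq[OF that])
  qed
  moreover have "Ck_on k S (\<lambda>x. \<Sum>b\<in>Basis.
      (frechet_derivative f (at x) v \<bullet> b) *\<^sub>R (frechet_derivative g (at (f x)) b))" for v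
  proof (intro Ck_on_sum Ck_on_scaleR Ck_on_inner Ck_on_const assms(1))
    show "Ck_on k S (\<lambda>x. frechet_derivative f (at x) v)"
      using Suc.prems(1) by simp
    show "Ck_on k S (\<lambda>x. frechet_derivative g (at (f x)) b)" for b
      using Suc.IH[OF Ck_on_SucD[OF Suc.prems(1)], of "\<lambda>y. frechet_derivative g (at y) b"] Suc.prems(2)
      by (simp add: o_def)
  qed
  ultimately show ?case by (rule Ck_on_SucI[OF assms(1)])
qed

lemma Ck_on_exp: "Ck_on k UNIV (exp :: real \<Rightarrow> real)"
proof (induction k)
  case (Suc k)
  have "(exp has_derivative (\<lambda>v. exp x * v)) (at x)" for x :: real
    using DERIV_exp has_field_derivative_def by blast
  then show ?case
    by (rule Ck_on_SucI[OF open_UNIV]) (auto intro!: Ck_on_mult Suc Ck_on_const)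
qed (auto intro: continuous_intros)

text \<open>The weight \<open>t ^ j\<close> makes this class of integrals closed under differentiation in \<open>x\<close>.\<close>

lemma Ck_on_segment_integral:
  fixes F :: "'a::euclidean_space \<Rightarrow> real"
  assumes "Ck_on k (ball a r) F"
  shows "Ck_on k (ball a r) (\<lambda>x. integral {0..1} (\<lambda>t. t ^ j * F (a + t *\<^sub>R (x - a))))"
  using assms
proof (induction k arbitrary: j F)
  \<comment> \<open>The ball is star-shaped about its centre, so the segment from \<open>a\<close>
    to \<open>x\<close> stays in the domain of \<open>F\<close>.\<close>
  have seg: "(\<lambda>p. a + snd p *\<^sub>R (fst p - a)) ` (ball a r \<times> cbox 0 (1::real)) \<subseteq> ball a r"
  proof clarsimp
    fix x and t :: real assume x: "dist a x < r" "0 \<le> t" "t \<le> 1"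
    have "dist a (a + t *\<^sub>R (x - a)) = t * dist a x" using x by (simp add: dist_norm norm_minus_commute)
    also have "\<dots> \<le> 1 * dist a x" using x by (intro mult_right_mono) auto
    finally show "dist a (a + t *\<^sub>R (x - a)) < r" using x by simp
  qed
  have cont: "continuous_on (ball a r \<times> cbox 0 (1::real)) (\<lambda>p. G (a + snd p *\<^sub>R (fst p - a)))"
    if "continuous_on (ball a r) G" for G :: "'a \<Rightarrow> real"
    by (rule continuous_on_compose2[OF that _ seg]) (intro continuous_intros)
  {
    case (0 j F)
    have "continuous_on (ball a r) (\<lambda>x. integral (cbox 0 1) (\<lambda>t. t ^ j * F (a + t *\<^sub>R (x - a))))"
      by (rule integral_continuous_on_param)
        (use 0 cont[of F] in \<open>auto intro!: continuous_intros simp: case_prod_unfold\<close>)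
    then show ?case by simp
  next
    case (Suc k j F)
    define D where "D b = (\<lambda>x. frechet_derivative F (at x) b)" for b
    have cD: "Ck_on k (ball a r) (D b)" for b
      using Suc.prems by (simp add: D_def)
    have cD0: "continuous_on (ball a r) (D b)" for b
      using cD[of b] by (induction k) (auto simp del: Ck_on.simps(2) dest: Ck_on_SucD)
    have cF: "continuous_on (ball a r) F"
      using Suc.prems by (auto intro!: differentiable_imp_continuous_within continuous_at_imp_continuous_on)
    \<comment> \<open>\<open>leibniz_rule\<close> takes the derivative as a bounded linear map,
      hence \<open>blinfun_inner_left\<close>. Differentiating the inner map
      \<open>a + t *\<^sub>R (x - a)\<close> contributes one factor \<open>t\<close>, which raises
      the weight from \<open>t ^ j\<close> to \<open>t ^ Suc j\<close>.\<close>
    define fx where "fx x t = (\<Sum>b\<in>Basis. (t ^ Suc j * D b (a + t *\<^sub>R (x - a))) *\<^sub>R blinfun_inner_left b)"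
      for x t
    have dF: "(F has_derivative (\<lambda>v. \<Sum>b\<in>Basis. (v \<bullet> b) * D b y)) (at y)" if "y \<in> ball a r" for y
    proof -
      have d: "(F has_derivative frechet_derivative F (at y)) (at y)"
        using Ck_on_Suc_has_derivative[OF Suc.prems that] .
      have "frechet_derivative F (at y) v = (\<Sum>b\<in>Basis. (v \<bullet> b) * D b y)" for v
        using linear_sum_Basis[OF has_derivative_linear[OF d], of v] by (simp add: D_def)
      then show ?thesis using d by presburger
    qed
    have 1: "((\<lambda>x. t ^ j * F (a + t *\<^sub>R (x - a))) has_derivative blinfun_apply (fx x t))
        (at x within ball a r)" if "x \<in> ball a r" "t \<in> cbox 0 1" for x t
    proof -
      have y: "a + t *\<^sub>R (x - a) \<in> ball a r" using seg that by force
      have "((\<lambda>x. a + t *\<^sub>R (x - a)) has_derivative (\<lambda>v. t *\<^sub>R v)) (at x)"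
        by (auto intro!: derivative_eq_intros)
      from diff_chain_at[OF this dF[OF y]]
      have "((\<lambda>x. F (a + t *\<^sub>R (x - a))) has_derivative
          (\<lambda>v. \<Sum>b\<in>Basis. (t *\<^sub>R v \<bullet> b) * D b (a + t *\<^sub>R (x - a)))) (at x)"
        by (simp add: o_def)
      note d = has_derivative_mult_right[OF this, of "t ^ j"]
      have "(\<lambda>v. t ^ j * (\<Sum>b\<in>Basis. (t *\<^sub>R v \<bullet> b) * D b (a + t *\<^sub>R (x - a)))) =
          blinfun_apply (fx x t)"
        unfolding fx_def blinfun.sum_left blinfun.scaleR_left sum_distrib_left
        by (intro ext sum.cong) (simp_all add: inner_commute)
      then show ?thesis
        using has_derivative_at_withinI[OF has_derivative_eq_rhs[OF d]] by blast
    qed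
    have 2: "(\<lambda>t. t ^ j * F (a + t *\<^sub>R (x - a))) integrable_on cbox 0 1" if "x \<in> ball a r" for x
    proof (rule integrable_continuous)
      have "continuous_on (cbox 0 1) (\<lambda>t. F (a + t *\<^sub>R (x - a)))"
        by (rule continuous_on_compose2[OF cF]) (use seg that in \<open>force intro!: continuous_intros\<close>)+
      then show "continuous_on (cbox 0 1) (\<lambda>t. t ^ j * F (a + t *\<^sub>R (x - a)))"
        by (intro continuous_intros)
    qed
    have 3: "continuous_on (ball a r \<times> cbox 0 1) (\<lambda>(x, t). fx x t)"
      unfolding fx_def case_prod_unfold
      by (intro continuous_intros cont[OF cD0])
    have d: "((\<lambda>x. integral (cbox 0 1) (\<lambda>t. t ^ j * F (a + t *\<^sub>R (x - a)))) has_derivative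
        blinfun_apply (integral (cbox 0 1) (fx x))) (at x)" if "x \<in> ball a r" for x
      using leibniz_rule[OF 1 2 3 that convex_ball] that
      by (simp add: at_within_open[OF that open_ball])
    have int: "fx x integrable_on cbox 0 1" if "x \<in> ball a r" for x
      by (rule integrable_continuous, rule continuous_on_compose2[OF 3[unfolded case_prod_unfold], 
            of _ "\<lambda>t. (x, t)", unfolded fst_conv snd_conv])
        (use that in \<open>auto intro!: continuous_intros\<close>)
    \<comment> \<open>In a fixed direction the derivative is a finite sum of integrals of the same
      kind with weight \<open>Suc j\<close> and integrand \<open>D b\<close>; this is why the
      induction leaves \<open>j\<close> and \<open>F\<close> arbitrary.\<close>
    have val: "blinfun_apply (integral (cbox 0 1) (fx x)) v =
        (\<Sum>b\<in>Basis. (v \<bullet> b) * integral {0..1} (\<lambda>t. t ^ Suc j * D b (a + t *\<^sub>R (x - a))))"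
      if x: "x \<in> ball a r" for x v
    proof -
      have i: "(\<lambda>t. t ^ Suc j * D b (a + t *\<^sub>R (x - a))) integrable_on cbox 0 1" for b
      proof (rule integrable_continuous)
        have "continuous_on (cbox 0 1) (\<lambda>t. D b (a + t *\<^sub>R (x - a)))"
          by (rule continuous_on_compose2[OF cD0]) (use seg x in \<open>force intro!: continuous_intros\<close>)+
        then show "continuous_on (cbox 0 1) (\<lambda>t. t ^ Suc j * D b (a + t *\<^sub>R (x - a)))"
          by (intro continuous_intros)
      qed
      have "blinfun_apply (integral (cbox 0 1) (fx x)) v = integral (cbox 0 1) (\<lambda>t. blinfun_apply (fx x t) v)"
        using integral_linear[OF int[OF x] blinfun.bounded_linear_left[of v]] by (simp add: o_def)
      also have "\<dots> = integral (cbox 0 1) (\<lambda>t. \<Sum>b\<in>Basis. (v \<bullet> b) * (t ^ Suc j * D b (a + t *\<^sub>R (x - a))))"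
        by (simp add: fx_def blinfun.sum_left blinfun.scaleR_left inner_commute mult_ac)
      also have "\<dots> = (\<Sum>b\<in>Basis. integral (cbox 0 1) (\<lambda>t. (v \<bullet> b) * (t ^ Suc j * D b (a + t *\<^sub>R (x - a)))))"
        by (intro integral_sum integrable_on_mult_right i) auto
      finally show ?thesis by simp
    qed
    show ?case
    proof (rule Ck_on_SucI[OF open_ball, where f' = "\<lambda>x. blinfun_apply (integral (cbox 0 1) (fx x))"])
      show "Ck_on k (ball a r) (\<lambda>x. blinfun_apply (integral (cbox 0 1) (fx x)) v)" for v
        by (rule Ck_on_cong[OF open_ball val[symmetric]])
          (auto intro!: Ck_on_sum Ck_on_mult Ck_on_const Suc.IH cD simp del: power_Suc)
    qed (use d in simp)
  }
qed

text \<open>Integrate the derivative of h(a + t (x - a)) over t in [0, 1] and expand the direction x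
  - a in the basis: \<open>G b\<close> is the mean of a partial derivative over the segment. At x =
  a the integrand is constant, which gives the value of \<open>G b a\<close>.\<close>

lemma hadamard:
  fixes h :: "'a::euclidean_space \<Rightarrow> real"
  assumes "smooth_on (ball a r) h"
  obtains G where "\<And>b. smooth_on (ball a r) (G b)"
    and "\<And>b. 0 < r \<Longrightarrow> G b a = frechet_derivative h (at a) b"
    and "\<And>x. x \<in> ball a r \<Longrightarrow> h x = h a + (\<Sum>b\<in>Basis. ((x - a) \<bullet> b) * G b x)"
proof
  \<comment> \<open>The factor \<open>t ^ 0\<close> is there to match
    \<open>Ck_on_segment_integral\<close> at \<open>j = 0\<close>.\<close>
  define G where "G b x = integral {0..1} (\<lambda>t. t ^ 0 * frechet_derivative h (at (a + t *\<^sub>R (x - a))) b)" for b x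
  have D: "smooth_on (ball a r) (\<lambda>x. frechet_derivative h (at x) b)" for b
    unfolding smooth_on_def
  proof
    fix k show "Ck_on k (ball a r) (\<lambda>x. frechet_derivative h (at x) b)"
      using assms[unfolded smooth_on_def, rule_format, of "Suc k"] by simp
  qed
  show "smooth_on (ball a r) (G b)" for b
    using D Ck_on_segment_integral unfolding G_def smooth_on_def by blast
  show "G b a = frechet_derivative h (at a) b" for b
    by (simp add: G_def)
  show "h x = h a + (\<Sum>b\<in>Basis. ((x - a) \<bullet> b) * G b x)" if x: "x \<in> ball a r" for x
  proof -
    have y: "a + t *\<^sub>R (x - a) \<in> ball a r" if t: "t \<in> {0..1}" for t :: real
    proof -
      have "dist a (a + t *\<^sub>R (x - a)) = t * dist a x" using t by (simp add: dist_norm norm_minus_commute)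
      also have "\<dots> \<le> 1 * dist a x" using t by (intro mult_right_mono) auto
      finally show ?thesis using x by simp
    qed
    have dh: "(h has_derivative frechet_derivative h (at y)) (at y)" if "y \<in> ball a r" for y
      using assms[unfolded smooth_on_def, rule_format, of "Suc 0"] Ck_on_Suc_has_derivative that by blast
    have v: "((\<lambda>t. h (a + t *\<^sub>R (x - a))) has_vector_derivative
        (\<Sum>b\<in>Basis. ((x - a) \<bullet> b) * frechet_derivative h (at (a + t *\<^sub>R (x - a))) b)) (at t within {0..1})"
      if t: "t \<in> {0..1}" for t
    proof -
      note d = dh[OF y[OF t]]
      have "((\<lambda>t. a + t *\<^sub>R (x - a)) has_derivative (\<lambda>s. s *\<^sub>R (x - a))) (at t)"
        by (auto intro!: derivative_eq_intros)
      note d' = diff_chain_at[OF this d]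
      have e: "frechet_derivative h (at (a + t *\<^sub>R (x - a))) (s *\<^sub>R (x - a)) = s *\<^sub>R
          (\<Sum>b\<in>Basis. ((x - a) \<bullet> b) * frechet_derivative h (at (a + t *\<^sub>R (x - a))) b)" for s
        using linear_sum_Basis[OF has_derivative_linear[OF d], of "x - a"]
          linear_scale[OF has_derivative_linear[OF d], of s "x - a"] by simp
      show ?thesis
        unfolding has_vector_derivative_def
        by (rule has_derivative_at_withinI[OF has_derivative_eq_rhs[OF d'[unfolded o_def]]], rule ext, rule e)
    qed
    have i: "(\<lambda>t. frechet_derivative h (at (a + t *\<^sub>R (x - a))) b) integrable_on {0..1}" for b
    proof (rule integrable_continuous_real)
      have c: "continuous_on (ball a r) (\<lambda>x. frechet_derivative h (at x) b)"
        using D[of b, unfolded smooth_on_def, rule_format, of 0] by simp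
      show "continuous_on {0..1} (\<lambda>t. frechet_derivative h (at (a + t *\<^sub>R (x - a))) b)"
        by (rule continuous_on_compose2[OF c]) (use y in \<open>force intro!: continuous_intros\<close>)+
    qed
    have "((\<lambda>t. \<Sum>b\<in>Basis. ((x - a) \<bullet> b) * frechet_derivative h (at (a + t *\<^sub>R (x - a))) b)
        has_integral h (a + 1 *\<^sub>R (x - a)) - h (a + 0 *\<^sub>R (x - a))) {0..1}"
      by (rule fundamental_theorem_of_calculus[OF _ v]) auto
    moreover have "((\<lambda>t. \<Sum>b\<in>Basis. ((x - a) \<bullet> b) * frechet_derivative h (at (a + t *\<^sub>R (x - a))) b)
        has_integral (\<Sum>b\<in>Basis. ((x - a) \<bullet> b) * G b x)) {0..1}"
      by (intro has_integral_sum has_integral_mult_right)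
        (use i in \<open>auto simp: G_def integrable_integral\<close>)
    ultimately have "h (a + 1 *\<^sub>R (x - a)) - h (a + 0 *\<^sub>R (x - a)) = (\<Sum>b\<in>Basis. ((x - a) \<bullet> b) * G b x)"
      by (rule has_integral_unique)
    then show ?thesis by simp
  qed
qed

subsection \<open>Charts and tangent vectors\<close>

lemma smooth_on_cong:
  "open S \<Longrightarrow> (\<And>x. x \<in> S \<Longrightarrow> f x = g x) \<Longrightarrow> smooth_on S f \<Longrightarrow> smooth_on S g"
  unfolding smooth_on_def using Ck_on_cong by blast

lemma smooth_on_subset: "smooth_on S f \<Longrightarrow> T \<subseteq> S \<Longrightarrow> smooth_on T f"
  unfolding smooth_on_def using Ck_on_subset by blast

lemma smooth_on_local:
  "(\<And>x. x \<in> S \<Longrightarrow> \<exists>T. open T \<and> x \<in> T \<and> smooth_on T f) \<Longrightarrow> smooth_on S f"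
  unfolding smooth_on_def by (meson Ck_on_local)

lemma smooth_on_const: "smooth_on S (\<lambda>x. c)"
  unfolding smooth_on_def using Ck_on_const by blast

lemma smooth_on_linear: "open S \<Longrightarrow> bounded_linear L \<Longrightarrow> smooth_on S L"
  unfolding smooth_on_def using Ck_on_linear by blast

lemma smooth_on_add:
  "open S \<Longrightarrow> smooth_on S f \<Longrightarrow> smooth_on S g \<Longrightarrow> smooth_on S (\<lambda>x. f x + g x)"
  unfolding smooth_on_def using Ck_on_add by blast

lemma smooth_on_mult:
  fixes f g :: "'a::euclidean_space \<Rightarrow> real"
  shows "open S \<Longrightarrow> smooth_on S f \<Longrightarrow> smooth_on S g \<Longrightarrow> smooth_on S (\<lambda>x. f x * g x)"
  unfolding smooth_on_def using Ck_on_mult by blast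

lemma smooth_on_compose:
  fixes f :: "'a::euclidean_space \<Rightarrow> 'b::euclidean_space"
  shows "open S \<Longrightarrow> open T \<Longrightarrow> f ` S \<subseteq> T \<Longrightarrow> smooth_on S f \<Longrightarrow> smooth_on T g \<Longrightarrow> smooth_on S (g \<circ> f)"
  unfolding smooth_on_def using Ck_on_compose by blast

lemma smooth_on_frechet_derivative:
  assumes "smooth_on S f"
  shows "smooth_on S (\<lambda>x. frechet_derivative f (at x) v)"
  unfolding smooth_on_def
proof
  fix k show "Ck_on k S (\<lambda>x. frechet_derivative f (at x) v)"
    using assms[unfolded smooth_on_def, rule_format, of "Suc k"] by simp
qed

lemma smooth_on_has_derivative:
  "smooth_on S f \<Longrightarrow> x \<in> S \<Longrightarrow> (f has_derivative frechet_derivative f (at x)) (at x)"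
  unfolding smooth_on_def using Ck_on_Suc_has_derivative by blast

section \<open>Charts and smooth functions on a manifold\<close>

lemma smooth_manifoldD:
  assumes "smooth_manifold M"
  shows "c \<in> atlas M \<Longrightarrow> is_chart (mtop M) c"
    and "(\<Union>c\<in>atlas M. fst c) = points M"
    and "c \<in> atlas M \<Longrightarrow> d \<in> atlas M \<Longrightarrow> smooth_transition c d"
  using assms unfolding smooth_manifold_def by blast+

lemma chartD:
  assumes "smooth_manifold M" "(U, x) \<in> atlas M"
  shows "openin (mtop M) U" "inj_on x U"
    and "\<And>V. openin (mtop M) V \<Longrightarrow> V \<subseteq> U \<Longrightarrow> open (x ` V)"
    and "\<And>B. open B \<Longrightarrow> openin (mtop M) {q \<in> U. x q \<in> B}"
proof -
  note smooth_manifoldD(1)[OF assms]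
  then have o: "openin (mtop M) U" and ox: "open (x ` U)"
    and h: "homeomorphic_map (subtopology (mtop M) U) (top_of_set (x ` U)) x"
    by (auto simp: is_chart_def)
  have ts: "topspace (subtopology (mtop M) U) = U"
    using openin_subset[OF o] by auto
  show "openin (mtop M) U" by (rule o)
  show "inj_on x U" using homeomorphic_imp_injective_map[OF h] ts by simp
  show "open (x ` V)" if "openin (mtop M) V" "V \<subseteq> U" for V
  proof -
    have "openin (subtopology (mtop M) U) V"
      using that o openin_open_subtopology by blast
    then have "openin (top_of_set (x ` U)) (x ` V)"
      using homeomorphic_imp_open_map[OF h] by (auto simp: open_map_def)
    then show ?thesis using ox openin_open_trans by blast
  qed
  show "openin (mtop M) {q \<in> U. x q \<in> B}" if "open B" for B
  proof -
    have "openin (top_of_set (x ` U)) (x ` U \<inter> B)" using that by auto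
    from openin_continuous_map_preimage[OF homeomorphic_imp_continuous_map[OF h] this]
    have "openin (subtopology (mtop M) U) {q \<in> U. x q \<in> B}"
      unfolding ts by (rule back_subst[of "openin _"]) auto
    then show ?thesis using o openin_trans_full by blast
  qed
qed

lemma chart_exists:
  assumes "smooth_manifold M" "p \<in> points M"
  obtains U x where "(U, x) \<in> atlas M" "p \<in> U"
proof -
  have "p \<in> (\<Union>c\<in>atlas M. fst c)" using assms(2) smooth_manifoldD(2)[OF assms(1)] by simp
  then show thesis using that by (metis UN_E prod.collapse)
qed

lemma smooth_funD:
  "smooth_fun M W h \<Longrightarrow> openin (mtop M) W"
  "smooth_fun M W h \<Longrightarrow> (U, x) \<in> atlas M \<Longrightarrow> smooth_on (x ` (U \<inter> W)) (h \<circ> inv_into U x)"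
  by (auto simp: smooth_fun_def)

lemma smooth_funI:
  "openin (mtop M) W \<Longrightarrow> (\<And>U x. (U, x) \<in> atlas M \<Longrightarrow> smooth_on (x ` (U \<inter> W)) (h \<circ> inv_into U x))
    \<Longrightarrow> smooth_fun M W h"
  by (auto simp: smooth_fun_def)

lemma smooth_fun_near: "smooth_fun M W h \<Longrightarrow> p \<in> W \<Longrightarrow> smooth_near M p h"
  by (auto simp: smooth_near_def)

text \<open>\<open>smooth_fun\<close> quantifies over the whole atlas, but the expression of
  \<open>h\<close> in another chart is the one in \<open>x\<close> composed with a smooth transition
  map, so one chart suffices.\<close>

lemma smooth_fun_chartI:
  assumes M: "smooth_manifold M" and c: "(U, x) \<in> atlas M" and V: "openin (mtop M) V" "V \<subseteq> U"
    and s: "smooth_on (x ` V) (h \<circ> inv_into U x)"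
  shows "smooth_fun M V h"
proof (rule smooth_funI[OF V(1)])
  fix U' x' assume c': "(U', x') \<in> atlas M"
  note C = chartD[OF M c] and C' = chartD[OF M c']
  have o: "open (x' ` (U' \<inter> V))" by (rule C'(3)) (use C'(1) V in auto)
  have "smooth_on (x' ` (U' \<inter> U)) (x \<circ> inv_into U' x')"
    using smooth_manifoldD(3)[OF M c' c] by (simp add: smooth_transition_def)
  then have t: "smooth_on (x' ` (U' \<inter> V)) (x \<circ> inv_into U' x')"
    by (rule smooth_on_subset) (use V in auto)
  have "smooth_on (x' ` (U' \<inter> V)) ((h \<circ> inv_into U x) \<circ> (x \<circ> inv_into U' x'))"
    by (rule smooth_on_compose[OF o C(3)[OF V] _ t s]) (use C'(2) in auto)
  then show "smooth_on (x' ` (U' \<inter> V)) (h \<circ> inv_into U' x')"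
    by (rule smooth_on_cong[OF o, rotated]) (use V C(2) C'(2) in auto)
qed

lemma smooth_fun_subset:
  assumes "smooth_fun M W h" "openin (mtop M) V" "V \<subseteq> W"
  shows "smooth_fun M V h"
  by (rule smooth_funI[OF assms(2)], rule smooth_on_subset[OF smooth_funD(2)[OF assms(1)]])
    (use assms(3) in auto)

lemma open_chart_image:
  "smooth_manifold M \<Longrightarrow> (U, x) \<in> atlas M \<Longrightarrow> openin (mtop M) W \<Longrightarrow> open (x ` (U \<inter> W))"
  using chartD by (metis inf_le1 openin_Int)

lemma smooth_fun_cong:
  assumes M: "smooth_manifold M" and "smooth_fun M W h" "\<And>q. q \<in> W \<Longrightarrow> h q = k q"
  shows "smooth_fun M W k"
proof (rule smooth_funI)
  show W: "openin (mtop M) W" using assms by (simp add: smooth_fun_def)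
  fix U x assume c: "(U, x) \<in> atlas M"
  show "smooth_on (x ` (U \<inter> W)) (k \<circ> inv_into U x)"
    by (rule smooth_on_cong[OF open_chart_image[OF M c W] _ smooth_funD(2)[OF assms(2) c]])
      (use chartD(2)[OF M c] assms(3) in auto)
qed

lemma smooth_fun_local:
  assumes M: "smooth_manifold M"
    and l: "\<And>p. p \<in> W \<Longrightarrow> \<exists>V. p \<in> V \<and> V \<subseteq> W \<and> smooth_fun M V h"
  shows "smooth_fun M W h"
proof (rule smooth_funI)
  show W: "openin (mtop M) W"
    by (subst openin_subopen) (metis l smooth_funD(1))
  fix U x assume c: "(U, x) \<in> atlas M"
  show "smooth_on (x ` (U \<inter> W)) (h \<circ> inv_into U x)"
  proof (rule smooth_on_local)
    fix z assume "z \<in> x ` (U \<inter> W)"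
    then obtain p where p: "p \<in> U" "p \<in> W" "z = x p" by auto
    obtain V where V: "p \<in> V" "smooth_fun M V h" using l[OF p(2)] by auto
    have "open (x ` (U \<inter> V))" by (rule open_chart_image[OF M c smooth_funD(1)[OF V(2)]])
    then show "\<exists>T. open T \<and> z \<in> T \<and> smooth_on T (h \<circ> inv_into U x)"
      using smooth_funD(2)[OF V(2) c] p V by blast
  qed
qed

lemma smooth_fun_const: "openin (mtop M) W \<Longrightarrow> smooth_fun M W (\<lambda>q. c)"
  by (rule smooth_funI) (auto simp: o_def smooth_on_const)

lemma smooth_fun_add:
  assumes "smooth_manifold M" "smooth_fun M W h" "smooth_fun M W k"
  shows "smooth_fun M W (\<lambda>q. h q + k q)"
  using smooth_on_add[OF open_chart_image[OF assms(1) _ smooth_funD(1)[OF assms(2)]]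
      smooth_funD(2)[OF assms(2)] smooth_funD(2)[OF assms(3)]]
  by (intro smooth_funI smooth_funD(1)[OF assms(2)]) (simp add: o_def)

lemma smooth_fun_mult:
  assumes "smooth_manifold M" "smooth_fun M W h" "smooth_fun M W k"
  shows "smooth_fun M W (\<lambda>q. h q * k q)"
  using smooth_on_mult[OF open_chart_image[OF assms(1) _ smooth_funD(1)[OF assms(2)]]
      smooth_funD(2)[OF assms(2)] smooth_funD(2)[OF assms(3)]]
  by (intro smooth_funI smooth_funD(1)[OF assms(2)]) (simp add: o_def)

lemma smooth_fun_sum:
  assumes "smooth_manifold M" "openin (mtop M) W" "\<And>i. i \<in> I \<Longrightarrow> smooth_fun M W (h i)"
  shows "smooth_fun M W (\<lambda>q. \<Sum>i\<in>I. h i q)"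
  using assms(3)
  by (induction I rule: infinite_finite_induct)
    (auto intro: smooth_fun_const[OF assms(2)] smooth_fun_add[OF assms(1)])

lemma smooth_fun_exp:
  assumes M: "smooth_manifold M" and h: "smooth_fun M W h"
  shows "smooth_fun M W (\<lambda>q. exp (h q))"
proof (rule smooth_funI[OF smooth_funD(1)[OF h]])
  fix U x assume c: "(U, x) \<in> atlas M"
  have "smooth_on (x ` (U \<inter> W)) (exp \<circ> (h \<circ> inv_into U x))"
    by (rule smooth_on_compose[OF open_chart_image[OF M c smooth_funD(1)[OF h]] open_UNIV _ smooth_funD(2)[OF h c]])
      (use Ck_on_exp in \<open>auto simp: smooth_on_def\<close>)
  then show "smooth_on (x ` (U \<inter> W)) ((\<lambda>q. exp (h q)) \<circ> inv_into U x)"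
    by (simp add: o_def)
qed

lemma smooth_near_common:
  assumes "smooth_near M p h" "smooth_near M p k"
  obtains W where "p \<in> W" "smooth_fun M W h" "smooth_fun M W k"
proof -
  obtain V W where "p \<in> V" "smooth_fun M V h" "p \<in> W" "smooth_fun M W k"
    using assms by (auto simp: smooth_near_def)
  moreover from this have "openin (mtop M) (V \<inter> W)" by (auto dest: smooth_funD)
  ultimately show thesis using that[of "V \<inter> W"] smooth_fun_subset by (metis IntI inf_le1 inf_le2)
qed

section \<open>Derivations and coordinate vectors\<close>

lemma tangent_add:
  "v \<in> tangent_space M p \<Longrightarrow> smooth_near M p h \<Longrightarrow> smooth_near M p k \<Longrightarrow>
    v (\<lambda>q. h q + k q) = v h + v k"
  and tangent_mult:
  "v \<in> tangent_space M p \<Longrightarrow> smooth_near M p h \<Longrightarrow> smooth_near M p k \<Longrightarrow>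
    v (\<lambda>q. h q * k q) = v h * k p + h p * v k"
  and tangent_cmult:
  "v \<in> tangent_space M p \<Longrightarrow> smooth_near M p h \<Longrightarrow> v (\<lambda>q. a * h q) = a * v h"
  and tangent_not_smooth:
  "v \<in> tangent_space M p \<Longrightarrow> \<not> smooth_near M p h \<Longrightarrow> v h = 0"
  unfolding tangent_space_def by blast+

lemma tangent_germ:
  assumes "v \<in> tangent_space M p" "smooth_near M p h" "smooth_near M p k" "openin (mtop M) W" "p \<in> W"
    "\<forall>q\<in>W. h q = k q"
  shows "v h = v k"
proof -
  have "\<forall>h k W. smooth_near M p h \<and> smooth_near M p k \<and> openin (mtop M) W \<and> p \<in> W \<and>
        (\<forall>q\<in>W. h q = k q) \<longrightarrow> v h = v k"
    using assms(1) unfolding tangent_space_def by simp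
  then show ?thesis using assms(2-6) by blast
qed

lemma tangent_cong:
  assumes "v \<in> tangent_space M p" "smooth_fun M W h" "smooth_fun M W k" "p \<in> W" "\<And>q. q \<in> W \<Longrightarrow> h q = k q"
  shows "v h = v k"
  using tangent_germ[OF assms(1) smooth_fun_near[OF assms(2,4)] smooth_fun_near[OF assms(3,4)]
      smooth_funD(1)[OF assms(2)] assms(4)] assms(5) by blast

lemma tangent_const:
  assumes "v \<in> tangent_space M p" "p \<in> points M"
  shows "v (\<lambda>q. c) = 0"
proof -
  have s: "smooth_near M p (\<lambda>q. c)" for c
    by (rule smooth_fun_near[OF smooth_fun_const[OF openin_topspace] assms(2)])
  \<comment> \<open>Leibniz applied to 1 = 1 * 1 gives v(1) = 2 v(1).\<close>
  have "v (\<lambda>q. 1) = 0" using tangent_mult[OF assms(1) s s, of 1 1] by simp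
  then show ?thesis using tangent_cmult[OF assms(1) s, of c 1] by simp
qed

lemma tangent_sum:
  assumes "smooth_manifold M" "v \<in> tangent_space M p" "p \<in> W" "\<And>i. i \<in> I \<Longrightarrow> smooth_fun M W (h i)" "finite I"
    "openin (mtop M) W"
  shows "v (\<lambda>q. \<Sum>i\<in>I. h i q) = (\<Sum>i\<in>I. v (h i))"
  using assms(5,4)
proof (induction I)
  case empty
  have "p \<in> points M" using assms(3,6) openin_subset by blast
  then show ?case using tangent_const[OF assms(2), of 0] by simp
next
  case (insert i I)
  have "smooth_near M p (h i)" by (rule smooth_fun_near[OF insert.prems assms(3)]) simp
  moreover have "smooth_near M p (\<lambda>q. \<Sum>i\<in>I. h i q)"
    by (rule smooth_fun_near[OF smooth_fun_sum[OF assms(1,6) insert.prems] assms(3)]) simp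
  ultimately show ?case using insert tangent_add[OF assms(2)] by simp
qed

lemma tangent_space_scaleR_add:
  assumes "v \<in> tangent_space M p" "w \<in> tangent_space M p"
  shows "a *\<^sub>R v + b *\<^sub>R w \<in> tangent_space M p"
proof -
  note lin = assms[THEN tangent_add] assms[THEN tangent_mult] assms[THEN tangent_cmult]
    assms[THEN tangent_not_smooth]
  show ?thesis
    unfolding tangent_space_def mem_Collect_eq
  proof (intro conjI allI impI)
    fix h k W
    assume "smooth_near M p h \<and> smooth_near M p k \<and> openin (mtop M) W \<and> p \<in> W \<and> (\<forall>q\<in>W. h q = k q)"
    then have "v h = v k" "w h = w k" using assms[THEN tangent_germ] by blast+
    then show "(a *\<^sub>R v + b *\<^sub>R w) h = (a *\<^sub>R v + b *\<^sub>R w) k" by (simp add: scaleR_fun_def)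
  qed (use lin in \<open>auto simp: scaleR_fun_def algebra_simps\<close>)
qed

lemma tangent_space_add: "v \<in> tangent_space M p \<Longrightarrow> w \<in> tangent_space M p \<Longrightarrow> v + w \<in> tangent_space M p"
  using tangent_space_scaleR_add[of v M p w 1 1] by simp

lemma tangent_space_scaleR: "v \<in> tangent_space M p \<Longrightarrow> a *\<^sub>R v \<in> tangent_space M p"
  using tangent_space_scaleR_add[of v M p v a 0] by simp

lemma tangent_space_diff: "v \<in> tangent_space M p \<Longrightarrow> w \<in> tangent_space M p \<Longrightarrow> v - w \<in> tangent_space M p"
  using tangent_space_scaleR_add[of v M p w 1 "-1"] by simp

lemma tangent_space_0: "v \<in> tangent_space M p \<Longrightarrow> 0 \<in> tangent_space M p"
  using tangent_space_scaleR[of v M p 0] by simp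

text \<open>The coordinate field with constant components \<open>u\<close>. The default 0 is the
  value that \<open>tangent_space\<close> prescribes on functions that are not smooth near the
  point.\<close>

definition chart_vec ::
    "('m, 'e::euclidean_space) manifold \<Rightarrow> 'm set \<Rightarrow> ('m \<Rightarrow> 'e) \<Rightarrow> 'e \<Rightarrow> 'm vfield" where
  "chart_vec M U x u p =
    (\<lambda>h. if smooth_near M p h then frechet_derivative (h \<circ> inv_into U x) (at (x p)) u else 0)"

lemma smooth_near_has_derivative:
  assumes "(U, x) \<in> atlas M" "p \<in> U" "smooth_near M p h"
  shows "((h \<circ> inv_into U x) has_derivative frechet_derivative (h \<circ> inv_into U x) (at (x p))) (at (x p))"
  using assms smooth_on_has_derivative[OF smooth_funD(2)] unfolding smooth_near_def by blast

lemma chart_vec_eqI: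
  assumes "(U, x) \<in> atlas M" "p \<in> U" "smooth_near M p h"
    and "((h \<circ> inv_into U x) has_derivative h') (at (x p))"
  shows "chart_vec M U x u p h = h' u"
  using has_derivative_unique[OF assms(4) smooth_near_has_derivative[OF assms(1-3)]] assms(3)
  by (simp add: chart_vec_def)

lemma chart_vec_in_tangent_space:
  assumes M: "smooth_manifold M" and c: "(U, x) \<in> atlas M" "p \<in> U"
  shows "chart_vec M U x u p \<in> tangent_space M p"
proof -
  note d = smooth_near_has_derivative[OF c]
  have i: "inv_into U x (x p) = p" using chartD(2)[OF M c(1)] c(2) by simp
  have cv: "chart_vec M U x u p h = frechet_derivative (h \<circ> inv_into U x) (at (x p)) u"
    if "smooth_near M p h" for h using that by (simp add: chart_vec_def)
  have 1: "chart_vec M U x u p (\<lambda>q. h q + k q) = chart_vec M U x u p h + chart_vec M U x u p k"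
      (is ?A)
    and 2: "chart_vec M U x u p (\<lambda>q. h q * k q) = chart_vec M U x u p h * k p + h p * chart_vec M U x u p k"
      (is ?B)
    if s: "smooth_near M p h" "smooth_near M p k" for h k
  proof -
    obtain W where W: "p \<in> W" "smooth_fun M W h" "smooth_fun M W k" by (rule smooth_near_common[OF s])
    note n = smooth_fun_near[OF smooth_fun_add[OF M W(2,3)] W(1)] smooth_fun_near[OF smooth_fun_mult[OF M W(2,3)] W(1)]
    show ?A
      using chart_vec_eqI[OF c n(1), of _ u] has_derivative_add[OF d[OF s(1)] d[OF s(2)]] cv[OF s(1)] cv[OF s(2)]
      by (simp add: o_def)
    show ?B
      using chart_vec_eqI[OF c n(2), of _ u] has_derivative_mult[OF d[OF s(1)] d[OF s(2)]] cv[OF s(1)] cv[OF s(2)]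
      by (simp add: o_def i)
  qed
  have 3: "chart_vec M U x u p (\<lambda>q. a * h q) = a * chart_vec M U x u p h" if s: "smooth_near M p h" for a h
  proof -
    obtain W where W: "p \<in> W" "smooth_fun M W h" using s by (auto simp: smooth_near_def)
    have "smooth_near M p (\<lambda>q. a * h q)"
      by (rule smooth_fun_near[OF smooth_fun_mult[OF M smooth_fun_const[OF smooth_funD(1)[OF W(2)]] W(2)] W(1)])
    from chart_vec_eqI[OF c this, of _ u] show ?thesis
      using has_derivative_mult_right[OF d[OF s], of a] cv[OF s] by (simp add: o_def)
  qed
  have 4: "chart_vec M U x u p h = chart_vec M U x u p k"
    if s: "smooth_near M p h" "smooth_near M p k" "openin (mtop M) W" "p \<in> W" "\<forall>q\<in>W. h q = k q" for h k W
  proof -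
    have o: "open (x ` (U \<inter> W))" by (rule open_chart_image[OF M c(1) s(3)])
    have "((k \<circ> inv_into U x) has_derivative frechet_derivative (h \<circ> inv_into U x) (at (x p))) (at (x p))"
      by (rule has_derivative_transform_within_open[OF d[OF s(1)] o])
        (use s c chartD(2)[OF M c(1)] in auto)
    from chart_vec_eqI[OF c s(2) this] show ?thesis by (simp add: cv[OF s(1)])
  qed
  show ?thesis
    unfolding tangent_space_def mem_Collect_eq
  proof (intro conjI allI impI)
    fix h assume "\<not> smooth_near M p h"
    then show "chart_vec M U x u p h = 0" by (simp add: chart_vec_def)
  qed (use 1 2 3 4 in blast)+
qed

lemma smooth_fun_coordinate:
  assumes M: "smooth_manifold M" and c: "(U, x) \<in> atlas M"
  shows "smooth_fun M U (\<lambda>q. x q \<bullet> b)"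
proof (rule smooth_fun_chartI[OF M c chartD(1)[OF M c] subset_refl])
  have o: "open (x ` U)" using chartD[OF M c] by blast
  show "smooth_on (x ` U) ((\<lambda>q. x q \<bullet> b) \<circ> inv_into U x)"
    by (rule smooth_on_cong[OF o _ smooth_on_linear[OF o bounded_linear_inner_left[of b]]])
      (use chartD(2)[OF M c] in auto)
qed

text \<open>The coordinate functions recover \<open>u\<close>, so a tangent vector has only one
  coordinate representation.\<close>

lemma chart_vec_coordinate:
  assumes M: "smooth_manifold M" and c: "(U, x) \<in> atlas M" "p \<in> U"
  shows "chart_vec M U x u p (\<lambda>q. x q \<bullet> b) = u \<bullet> b"
proof (rule chart_vec_eqI[OF c])
  show "smooth_near M p (\<lambda>q. x q \<bullet> b)" using smooth_fun_near[OF smooth_fun_coordinate[OF M c(1)] c(2)] .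
  have o: "open (x ` U)" using chartD[OF M c(1)] by blast
  have "((\<lambda>z. z \<bullet> b) has_derivative (\<lambda>z. z \<bullet> b)) (at (x p))"
    by (simp add: bounded_linear_imp_has_derivative bounded_linear_inner_left)
  then show "((\<lambda>q. x q \<bullet> b) \<circ> inv_into U x has_derivative (\<lambda>z. z \<bullet> b)) (at (x p))"
    by (rule has_derivative_transform_within_open[OF _ o]) (use c chartD(2)[OF M c(1)] in auto)
qed

text \<open>By Hadamard's lemma the germ of \<open>h\<close> is a constant plus products of
  coordinate differences with smooth functions. A derivation kills the constant and sees the
  products only through its values on the coordinates; these values are the components of
  \<open>u\<close>.\<close>

lemma tangent_eq_chart_vec:
  assumes M: "smooth_manifold M" and c: "(U, x) \<in> atlas M" "p \<in> U" and v: "v \<in> tangent_space M p"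
  obtains u where "v = chart_vec M U x u p"
proof
  define u where "u = (\<Sum>b\<in>Basis. v (\<lambda>q. x q \<bullet> b) *\<^sub>R b)"
  note C = chartD[OF M c(1)]
  have pt: "p \<in> points M" using C(1) c(2) openin_subset by blast
  show "v = chart_vec M U x u p"
  proof
    fix h
    show "v h = chart_vec M U x u p h"
    proof (cases "smooth_near M p h")
      case False
      then show ?thesis using tangent_not_smooth[OF v] by (simp add: chart_vec_def)
    next
      case True
      then obtain W where W: "p \<in> W" "smooth_fun M W h" by (auto simp: smooth_near_def)
      have oW: "openin (mtop M) W" using W(2) smooth_funD by blast
      have "open (x ` (U \<inter> W))" by (rule open_chart_image[OF M c(1) oW])
      then obtain r where r: "r > 0" "ball (x p) r \<subseteq> x ` (U \<inter> W)"
        using c(2) W(1) open_contains_ball by (metis IntI imageI)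
      define H where "H = h \<circ> inv_into U x"
      have sH: "smooth_on (ball (x p) r) H"
        unfolding H_def using smooth_on_subset[OF smooth_funD(2)[OF W(2) c(1)] r(2)] .
      obtain G where G: "\<And>b. smooth_on (ball (x p) r) (G b)"
        and Gp': "\<And>b. 0 < r \<Longrightarrow> G b (x p) = frechet_derivative H (at (x p)) b"
        and HG: "\<And>z. z \<in> ball (x p) r \<Longrightarrow> H z = H (x p) + (\<Sum>b\<in>Basis. ((z - x p) \<bullet> b) * G b z)"
        by (fact hadamard[OF sH])
      note Gp = Gp'[OF r(1)]
      \<comment> \<open>On \<open>V\<close> the chart takes values in the ball where the expansion
        is valid; injectivity of \<open>x\<close> puts \<open>V\<close> inside the domain
        \<open>W\<close> of \<open>h\<close>.\<close>
      define V where "V = {q \<in> U. x q \<in> ball (x p) r}"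
      have V: "openin (mtop M) V" "V \<subseteq> U" "p \<in> V" using C(4)[OF open_ball] c(2) r(1) by (auto simp: V_def)
      have VW: "V \<subseteq> W"
      proof
        fix q assume q: "q \<in> V"
        then obtain q' where "q' \<in> U \<inter> W" "x q = x q'" using r(2) by (auto simp: V_def)
        then show "q \<in> W" using q C(2) V(2) by (metis Int_iff inj_onD subsetD)
      qed
      have sG: "smooth_fun M V (\<lambda>q. G b (x q))" for b
      proof (rule smooth_fun_chartI[OF M c(1) V(1,2)])
        have o: "open (x ` V)" using C(3) V by blast
        show "smooth_on (x ` V) ((\<lambda>q. G b (x q)) \<circ> inv_into U x)"
          by (rule smooth_on_cong[OF o _ smooth_on_subset[OF G[of b]]]) (use C(2) in \<open>auto simp: V_def\<close>)
      qed
      have sx: "smooth_fun M V (\<lambda>q. x q \<bullet> b)" for b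
        by (rule smooth_fun_subset[OF smooth_fun_coordinate[OF M c(1)] V(1,2)])
      have sx': "smooth_fun M V (\<lambda>q. x q \<bullet> b + - (x p \<bullet> b))" for b
        by (rule smooth_fun_add[OF M sx smooth_fun_const[OF V(1)]])
      have sm: "smooth_fun M V (\<lambda>q. (x q \<bullet> b + - (x p \<bullet> b)) * G b (x q))" for b
        by (rule smooth_fun_mult[OF M sx' sG])
      have "v h = v (\<lambda>q. h p + (\<Sum>b\<in>Basis. (x q \<bullet> b + - (x p \<bullet> b)) * G b (x q)))"
      proof (rule tangent_cong[OF v smooth_fun_subset[OF W(2) V(1) VW] _ V(3)])
        show "smooth_fun M V (\<lambda>q. h p + (\<Sum>b\<in>Basis. (x q \<bullet> b + - (x p \<bullet> b)) * G b (x q)))"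
          by (rule smooth_fun_add[OF M smooth_fun_const[OF V(1)] smooth_fun_sum[OF M V(1) sm]])
        fix q assume q: "q \<in> V"
        then have "inv_into U x (x q) = q" "inv_into U x (x p) = p" using V(2) C(2) c(2) by auto
        then show "h q = h p + (\<Sum>b\<in>Basis. (x q \<bullet> b + - (x p \<bullet> b)) * G b (x q))"
          using HG[of "x q"] q by (simp add: H_def V_def inner_diff_left)
      qed
      also have "\<dots> = (\<Sum>b\<in>Basis. v (\<lambda>q. (x q \<bullet> b + - (x p \<bullet> b)) * G b (x q)))"
      proof -
        have n: "smooth_near M p (\<lambda>q. \<Sum>b\<in>Basis. (x q \<bullet> b + - (x p \<bullet> b)) * G b (x q))"
          by (rule smooth_fun_near[OF smooth_fun_sum[OF M V(1) sm] V(3)])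
        have "v (\<lambda>q. \<Sum>b\<in>Basis. (x q \<bullet> b + - (x p \<bullet> b)) * G b (x q)) =
            (\<Sum>b\<in>Basis. v (\<lambda>q. (x q \<bullet> b + - (x p \<bullet> b)) * G b (x q)))"
          by (rule tangent_sum[OF M v V(3) sm finite_Basis V(1)])
        then show ?thesis
          using tangent_add[OF v smooth_fun_near[OF smooth_fun_const[OF V(1)] V(3)] n, of "h p"]
            tangent_const[OF v pt, of "h p"] by linarith
      qed
      \<comment> \<open>The coordinate differences vanish at \<open>p\<close>, so the Leibniz term
        with a derivative of \<open>G b\<close> drops out.\<close>
      also have "\<dots> = (\<Sum>b\<in>Basis. v (\<lambda>q. x q \<bullet> b) * G b (x p))"
      proof (rule sum.cong[OF refl])
        fix b
        show "v (\<lambda>q. (x q \<bullet> b + - (x p \<bullet> b)) * G b (x q)) = v (\<lambda>q. x q \<bullet> b) * G b (x p)"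
          using tangent_mult[OF v smooth_fun_near[OF sx' V(3)] smooth_fun_near[OF sG V(3)], of b b]
            tangent_add[OF v smooth_fun_near[OF sx V(3)] smooth_fun_near[OF smooth_fun_const[OF V(1)] V(3)], of b "- (x p \<bullet> b)"]
            tangent_const[OF v pt] by simp
      qed
      also have "\<dots> = frechet_derivative H (at (x p)) u"
      proof -
        have "linear (frechet_derivative H (at (x p)))"
          using smooth_near_has_derivative[OF c True] has_derivative_linear unfolding H_def by blast
        then show ?thesis by (simp add: u_def Gp linear_sum linear_scale)
      qed
      finally show ?thesis using True by (simp add: chart_vec_def H_def)
    qed
  qed
qed

lemma smooth_vfield_chart_vec:
  assumes M: "smooth_manifold M" and c: "(U, x) \<in> atlas M"
  shows "smooth_vfield M U (chart_vec M U x u)"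
  unfolding smooth_vfield_def
proof (intro conjI ballI allI impI)
  note C = chartD[OF M c]
  show "openin (mtop M) U" by (rule C(1))
  show "chart_vec M U x u p \<in> tangent_space M p" if "p \<in> U" for p
    by (rule chart_vec_in_tangent_space[OF M c that])
  fix V h assume V: "V \<subseteq> U \<and> smooth_fun M V h"
  then have oV: "openin (mtop M) V" and VU: "V \<subseteq> U" and sV: "smooth_fun M V h" using smooth_funD by auto
  have o: "open (x ` V)" by (rule C(3)[OF oV VU])
  show "smooth_fun M V (\<lambda>p. chart_vec M U x u p h)"
  proof (rule smooth_fun_chartI[OF M c oV VU])
    have "smooth_on (x ` V) (\<lambda>z. frechet_derivative (h \<circ> inv_into U x) (at z) u)"
      using smooth_on_frechet_derivative[OF smooth_funD(2)[OF sV c]] VU by (simp add: Int_absorb1)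
    then show "smooth_on (x ` V) ((\<lambda>p. chart_vec M U x u p h) \<circ> inv_into U x)"
      by (rule smooth_on_cong[OF o, rotated])
        (use VU C(2) smooth_fun_near[OF sV] in \<open>auto simp: chart_vec_def\<close>)
  qed
qed

text \<open>The derivation laws contain sums and products but no chain rule; writing
  \<open>v\<close> as a coordinate derivative supplies it.\<close>

lemma tangent_exp:
  assumes M: "smooth_manifold M" and v: "v \<in> tangent_space M p" and h: "smooth_fun M W h" "p \<in> W"
  shows "v (\<lambda>q. exp (h q)) = exp (h p) * v h"
proof -
  have "p \<in> points M" using h smooth_funD(1) openin_subset by blast
  then obtain U x where c: "(U, x) \<in> atlas M" "p \<in> U" using chart_exists[OF M] by blast
  obtain u where u: "v = chart_vec M U x u p" using tangent_eq_chart_vec[OF M c v] .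
  have n: "smooth_near M p h" "smooth_near M p (\<lambda>q. exp (h q))"
    using smooth_fun_near[OF h] smooth_fun_near[OF smooth_fun_exp[OF M h(1)] h(2)] .
  have "inv_into U x (x p) = p" using chartD(2)[OF M c(1)] c(2) by simp
  then have "((\<lambda>q. exp (h q)) \<circ> inv_into U x has_derivative
      (\<lambda>u. frechet_derivative (h \<circ> inv_into U x) (at (x p)) u * exp (h p))) (at (x p))"
    using has_derivative_exp[OF smooth_near_has_derivative[OF c n(1)]] by (simp add: o_def)
  from chart_vec_eqI[OF c n(2) this, of u] n(1) show ?thesis by (simp add: u chart_vec_def)
qed

subsection \<open>Submanifolds\<close>

lemma smooth_vfieldD:
  assumes "smooth_vfield M W X"
  shows "openin (mtop M) W" "p \<in> W \<Longrightarrow> X p \<in> tangent_space M p"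
    and "V \<subseteq> W \<Longrightarrow> smooth_fun M V h \<Longrightarrow> smooth_fun M V (\<lambda>p. X p h)"
    and "p \<in> W \<Longrightarrow> p \<in> points M"
  using assms openin_subset unfolding smooth_vfield_def by blast+

lemma smooth_vfieldI:
  assumes "openin (mtop M) W" "\<And>p. p \<in> W \<Longrightarrow> X p \<in> tangent_space M p"
    and "\<And>V h. V \<subseteq> W \<Longrightarrow> smooth_fun M V h \<Longrightarrow> smooth_fun M V (\<lambda>p. X p h)"
  shows "smooth_vfield M W X"
  using assms unfolding smooth_vfield_def by simp

lemma smooth_vfield_subset:
  assumes "smooth_vfield M W X" "openin (mtop M) V" "V \<subseteq> W"
  shows "smooth_vfield M V X"
proof (rule smooth_vfieldI[OF assms(2)])
  show "X p \<in> tangent_space M p" if "p \<in> V" for p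
    using smooth_vfieldD(2)[OF assms(1)] that assms(3) by blast
  show "smooth_fun M V' (\<lambda>p. X p h)" if "V' \<subseteq> V" "smooth_fun M V' h" for V' h
    by (rule smooth_vfieldD(3)[OF assms(1) _ that(2)]) (use that assms(3) in blast)
qed

lemma smooth_vfield_cong:
  assumes M: "smooth_manifold M" and "smooth_vfield M W X" "\<And>p. p \<in> W \<Longrightarrow> X p = Y p"
  shows "smooth_vfield M W Y"
proof (rule smooth_vfieldI[OF smooth_vfieldD(1)[OF assms(2)]])
  show "Y p \<in> tangent_space M p" if "p \<in> W" for p
    using smooth_vfieldD(2)[OF assms(2) that] assms(3)[OF that] by simp
  show "smooth_fun M V (\<lambda>p. Y p h)" if "V \<subseteq> W" "smooth_fun M V h" for V h
    by (rule smooth_fun_cong[OF M smooth_vfieldD(3)[OF assms(2) that]]) (use assms(3) that in auto)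
qed

lemma smooth_vfield_add:
  assumes M: "smooth_manifold M" and X: "smooth_vfield M W X" and Y: "smooth_vfield M W Y"
  shows "smooth_vfield M W (\<lambda>q. X q + Y q)"
proof (rule smooth_vfieldI[OF smooth_vfieldD(1)[OF X]])
  show "X p + Y p \<in> tangent_space M p" if "p \<in> W" for p
    using smooth_vfieldD(2)[OF X that] smooth_vfieldD(2)[OF Y that] by (rule tangent_space_add)
  show "smooth_fun M V (\<lambda>p. (X p + Y p) h)" if "V \<subseteq> W" "smooth_fun M V h" for V h
    using smooth_fun_add[OF M smooth_vfieldD(3)[OF X that] smooth_vfieldD(3)[OF Y that]] by simp
qed

lemma smooth_vfield_scaleR:
  assumes M: "smooth_manifold M" and X: "smooth_vfield M W X" and k: "smooth_fun M W k"
  shows "smooth_vfield M W (\<lambda>q. k q *\<^sub>R X q)"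
proof (rule smooth_vfieldI[OF smooth_vfieldD(1)[OF X]])
  show "k p *\<^sub>R X p \<in> tangent_space M p" if "p \<in> W" for p
    using smooth_vfieldD(2)[OF X that] by (rule tangent_space_scaleR)
  show "smooth_fun M V (\<lambda>p. (k p *\<^sub>R X p) h)" if "V \<subseteq> W" "smooth_fun M V h" for V h
    using smooth_fun_mult[OF M smooth_fun_subset[OF k smooth_funD(1)[OF that(2)] that(1)] smooth_vfieldD(3)[OF X that]]
    by (simp add: scaleR_fun_def)
qed

lemma chart_vec_scaleR_add:
  assumes "(U, x) \<in> atlas M" "p \<in> U"
  shows "chart_vec M U x (u + t *\<^sub>R w) p = chart_vec M U x u p + t *\<^sub>R chart_vec M U x w p"
proof
  fix h
  show "chart_vec M U x (u + t *\<^sub>R w) p h = (chart_vec M U x u p + t *\<^sub>R chart_vec M U x w p) h"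
  proof (cases "smooth_near M p h")
    case True
    have "linear (frechet_derivative (h \<circ> inv_into U x) (at (x p)))"
      using smooth_near_has_derivative[OF assms True] by (rule has_derivative_linear)
    then show ?thesis using True by (simp add: chart_vec_def scaleR_fun_def linear_add linear_scale)
  qed (simp add: chart_vec_def scaleR_fun_def)
qed

section \<open>The inclusion of a submanifold and its differential\<close>

lemma push_scaleR_add: "push M p (a *\<^sub>R v + b *\<^sub>R w) = a *\<^sub>R push M p v + b *\<^sub>R push M p w"
  by (rule ext) (simp add: push_def scaleR_fun_def)

lemma push_diff: "push M p (v - w) = push M p v - push M p w"
  by (rule ext) (simp add: push_def)

lemma embedded_submanifoldD:
  assumes "embedded_submanifold M S"
  shows "smooth_manifold M" "smooth_manifold S" "points S \<subseteq> points M"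
    "mtop S = subtopology (mtop M) (points S)"
    and "p \<in> points S \<Longrightarrow> \<exists>U x y L. (U, x) \<in> atlas M \<and> p \<in> U \<and> (U \<inter> points S, y) \<in> atlas S \<and>
        linear (L :: 'f::euclidean_space \<Rightarrow> 'e::euclidean_space) \<and> inj L \<and>
        x ` (U \<inter> points S) = x ` U \<inter> range L \<and> (\<forall>q\<in>U \<inter> points S. x q = L (y q))"
  using assms unfolding embedded_submanifold_def by blast+

lemma openin_submanifold:
  assumes "embedded_submanifold M S" "openin (mtop M) W"
  shows "openin (mtop S) (W \<inter> points S)"
  by (subst embedded_submanifoldD(4)[OF assms(1)]) (use assms(2) in \<open>auto simp: openin_subtopology\<close>)

text \<open>In these coordinates the inclusion of \<open>S\<close> is the injective linear map
  \<open>L\<close>, so restricting functions, differentiating the inclusion and extending functions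
  all become linear algebra.\<close>

locale slice_chart =
  fixes M :: "('m, 'e::euclidean_space) manifold" and S :: "('m, 'f::euclidean_space) manifold"
    and U :: "'m set" and x :: "'m \<Rightarrow> 'e" and y :: "'m \<Rightarrow> 'f" and L :: "'f \<Rightarrow> 'e"
  assumes E: "embedded_submanifold M S" and c: "(U, x) \<in> atlas M" and d: "(U \<inter> points S, y) \<in> atlas S"
    and L: "linear L" "inj L" and xL: "q \<in> U \<inter> points S \<Longrightarrow> x q = L (y q)"
begin

lemmas M = embedded_submanifoldD(1)[OF E] and S = embedded_submanifoldD(2)[OF E]
lemmas C = chartD[OF M c] and D = chartD[OF S d]

lemma inv_slice: "q \<in> U \<inter> points S \<Longrightarrow> inv_into U x (L (y q)) = inv_into (U \<inter> points S) y (y q)"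
  using xL[of q, symmetric] C(2) D(2) by simp

lemma bounded_L: "bounded_linear L"
  using L(1) linear_conv_bounded_linear by blast

lemma smooth_fun_slice:
  assumes "smooth_fun M W h"
  shows "smooth_fun S (W \<inter> (U \<inter> points S)) h"
proof (rule smooth_fun_chartI[OF S d])
  have W: "openin (mtop M) W" using assms by (rule smooth_funD)
  have "openin (mtop S) ((W \<inter> U) \<inter> points S)"
    by (rule openin_submanifold[OF E]) (use C(1) W in auto)
  then show V: "openin (mtop S) (W \<inter> (U \<inter> points S))" by (simp add: Int_assoc)
  have o: "open (y ` (W \<inter> (U \<inter> points S)))" by (rule D(3)[OF V]) auto
  have "smooth_on (y ` (W \<inter> (U \<inter> points S))) ((h \<circ> inv_into U x) \<circ> L)"
    by (rule smooth_on_compose[OF o open_chart_image[OF M c W] _ smooth_on_linear[OF o bounded_L] smooth_funD(2)[OF assms c]])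
      (use xL in force)
  then show "smooth_on (y ` (W \<inter> (U \<inter> points S))) (h \<circ> inv_into (U \<inter> points S) y)"
    by (rule smooth_on_cong[OF o, rotated]) (use inv_slice in force)
qed auto

text \<open>A linear map is its own derivative, so the chain rule turns the differential of the
  inclusion into \<open>L\<close> acting on components.\<close>

lemma push_chart_vec:
  assumes p: "p \<in> U" "p \<in> points S"
  shows "push M p (chart_vec S (U \<inter> points S) y u p) = chart_vec M U x (L u) p"
proof
  fix h
  show "push M p (chart_vec S (U \<inter> points S) y u p) h = chart_vec M U x (L u) p h"
  proof (cases "smooth_near M p h")
    case False
    then show ?thesis by (simp add: push_def chart_vec_def)
  next
    case True
    then obtain W where W: "p \<in> W" "smooth_fun M W h" by (auto simp: smooth_near_def)
    have n: "smooth_near S p h" by (rule smooth_fun_near[OF smooth_fun_slice[OF W(2)]]) (use p W in auto)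
    have o: "open (y ` (U \<inter> points S))" using D by blast
    have p': "p \<in> U \<inter> points S" using p by blast
    have "((h \<circ> inv_into U x) \<circ> L has_derivative frechet_derivative (h \<circ> inv_into U x) (at (x p)) \<circ> L) (at (y p))"
      by (rule diff_chain_at[OF bounded_linear_imp_has_derivative[OF bounded_L]])
        (use smooth_near_has_derivative[OF c p(1) True] xL[OF p'] in simp)
    then have "(h \<circ> inv_into (U \<inter> points S) y has_derivative frechet_derivative (h \<circ> inv_into U x) (at (x p)) \<circ> L) (at (y p))"
      by (rule has_derivative_transform_within_open[OF _ o]) (use p' inv_slice in force)+
    from chart_vec_eqI[OF d p' n this] show ?thesis using True by (simp add: push_def chart_vec_def)
  qed
qed

text \<open>A linear left inverse \<open>P\<close> of \<open>L\<close> acts as a projection onto the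
  slice: extend \<open>h\<close> to be constant along the fibres of \<open>P\<close>.\<close>

lemma smooth_fun_extend:
  assumes h: "smooth_fun S V h" and p: "p \<in> V" "p \<in> U"
  shows "\<exists>W H. p \<in> W \<and> smooth_fun M W H \<and> (\<forall>q\<in>W \<inter> points S. q \<in> V \<and> H q = h q)"
proof -
  obtain P where P: "linear P" "P \<circ> L = id" using linear_injective_left_inverse[OF L] by blast
  have PL: "P (L z) = z" for z using P(2) by (metis comp_apply id_apply)
  have bP: "bounded_linear P" using P(1) linear_conv_bounded_linear by blast
  have oV: "openin (mtop S) V" using h by (rule smooth_funD)
  have VS: "V \<subseteq> points S" using oV openin_subset by blast
  have oB: "open (y ` ((U \<inter> points S) \<inter> V))" by (rule open_chart_image[OF S d oV])
  \<comment> \<open>The preimage under \<open>P\<close> makes \<open>H\<close> well defined on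
    \<open>W\<close> and also forces the points of \<open>W\<close> on \<open>S\<close> to lie in
    \<open>V\<close>.\<close>
  define W where "W = {q \<in> U. x q \<in> P -` (y ` ((U \<inter> points S) \<inter> V))}"
  have W: "openin (mtop M) W"
    unfolding W_def by (rule C(4)) (use oB bP continuous_open_vimage linear_continuous_at in blast)
  have WU: "W \<subseteq> U" by (auto simp: W_def)
  have oW: "open (x ` W)" by (rule C(3)[OF W WU])
  define H where "H = (\<lambda>q. h (inv_into (U \<inter> points S) y (P (x q))))"
  have "smooth_on (x ` W) ((h \<circ> inv_into (U \<inter> points S) y) \<circ> P)"
    by (rule smooth_on_compose[OF oW oB _ smooth_on_linear[OF oW bP] smooth_funD(2)[OF h d]]) (auto simp: W_def)
  then have "smooth_on (x ` W) (H \<circ> inv_into U x)"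
    by (rule smooth_on_cong[OF oW, rotated]) (use WU C(2) in \<open>auto simp: H_def\<close>)
  then have "smooth_fun M W H" by (rule smooth_fun_chartI[OF M c W WU])
  moreover have "p \<in> W" using p VS xL[of p] PL by (auto simp: W_def)
  moreover have "q \<in> V \<and> H q = h q" if qW: "q \<in> W \<inter> points S" for q
  proof -
    have q: "q \<in> U \<inter> points S" using qW WU by blast
    then have e: "P (x q) = y q" using xL PL by simp
    then obtain q' where "q' \<in> (U \<inter> points S) \<inter> V" "y q = y q'" using qW by (auto simp: W_def)
    then have "q \<in> V" using q D(2) by (metis Int_iff inj_onD)
    then show ?thesis using e D(2) q by (simp add: H_def)
  qed
  ultimately show ?thesis by blast
qed

end

lemma slice_chart_exists:
  assumes "embedded_submanifold M S" "p \<in> points S"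
  obtains U x y L where "slice_chart M S U x y L" "p \<in> U"
proof -
  from embedded_submanifoldD(5)[OF assms] obtain U x y L where
    "(U, x) \<in> atlas M" "p \<in> U" "(U \<inter> points S, y) \<in> atlas S"
    "linear L" "inj L" "\<forall>q\<in>U \<inter> points S. x q = L (y q)" by metis
  then have "slice_chart M S U x y L" using assms(1) by (intro slice_chart.intro) auto
  then show thesis using \<open>p \<in> U\<close> that by blast
qed

lemma smooth_fun_restrict:
  assumes E: "embedded_submanifold M S" and h: "smooth_fun M W h"
  shows "smooth_fun S (W \<inter> points S) h"
proof (rule smooth_fun_local[OF embedded_submanifoldD(2)[OF E]])
  fix p assume p: "p \<in> W \<inter> points S"
  then have "p \<in> points S" by blast
  from slice_chart_exists[OF E this] obtain U x y L where s: "slice_chart M S U x y L" "p \<in> U" .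
  show "\<exists>V. p \<in> V \<and> V \<subseteq> W \<inter> points S \<and> smooth_fun S V h"
    by (intro exI[of _ "W \<inter> (U \<inter> points S)"] conjI slice_chart.smooth_fun_slice[OF s(1) h]) (use p s in auto)
qed

lemma smooth_near_restrict:
  assumes "embedded_submanifold M S" "smooth_near M p h" "p \<in> points S"
  shows "smooth_near S p h"
  using assms smooth_fun_restrict[OF assms(1)] unfolding smooth_near_def by blast

lemma push_in_tangent_space:
  assumes E: "embedded_submanifold M S" and p: "p \<in> points S" and v: "v \<in> tangent_space S p"
  shows "push M p v \<in> tangent_space M p"
proof -
  obtain U x y L where s: "slice_chart M S U x y L" and U: "p \<in> U" by (rule slice_chart_exists[OF E p])
  interpret slice_chart M S U x y L by (rule s)
  obtain u where "v = chart_vec S (U \<inter> points S) y u p"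
    by (rule tangent_eq_chart_vec[OF S d _ v]) (use p U in auto)
  then show ?thesis using push_chart_vec[OF U p] chart_vec_in_tangent_space[OF M c U] by simp
qed

text \<open>The inclusion is an immersion: evaluating on the ambient coordinates gives
  \<open>L u = 0\<close>, and \<open>L\<close> is injective.\<close>

lemma push_eq_0:
  assumes E: "embedded_submanifold M S" and p: "p \<in> points S" and v: "v \<in> tangent_space S p" "push M p v = 0"
  shows "v = 0"
proof -
  obtain U x y L where s: "slice_chart M S U x y L" and U: "p \<in> U" by (rule slice_chart_exists[OF E p])
  interpret slice_chart M S U x y L by (rule s)
  have p': "p \<in> U \<inter> points S" using U p by blast
  obtain u where u: "v = chart_vec S (U \<inter> points S) y u p"
    by (rule tangent_eq_chart_vec[OF S d p' v(1)])
  then have "chart_vec M U x (L u) p = 0" using push_chart_vec[OF U p] v(2) by simp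
  then have "L u \<bullet> b = 0" for b using chart_vec_coordinate[OF M c U, of "L u" b] by simp
  then have "L u = 0" using inner_eq_zero_iff by blast
  then have "u = 0" using L linear_injective_0 by blast
  \<comment> \<open>The instance 0 = 0 + 1 * 0 says that the coordinate vector with components 0
    equals its own double.\<close>
  then show ?thesis using chart_vec_scaleR_add[OF d p', of 0 1 0] by (simp add: u)
qed

lemma push_inject:
  assumes "embedded_submanifold M S" "p \<in> points S" "v \<in> tangent_space S p" "w \<in> tangent_space S p"
    "push M p v = push M p w"
  shows "v = w"
  using push_eq_0[OF assms(1,2) tangent_space_diff[OF assms(3,4)]] assms(5) by (simp add: push_diff)

text \<open>Fields related by the inclusion. Smoothness is demanded of the ambient field only,
  because that of \<open>X'\<close> follows, see \<open>restricts_to_smooth_vfield\<close>.\<close>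

definition restricts_to ::
    "('m, 'e::euclidean_space) manifold \<Rightarrow> ('m, 'f::euclidean_space) manifold \<Rightarrow> 'm set \<Rightarrow>
     'm vfield \<Rightarrow> 'm vfield \<Rightarrow> bool" where
  "restricts_to M S W X X' \<longleftrightarrow> smooth_vfield M W X \<and>
     (\<forall>q\<in>W \<inter> points S. X' q \<in> tangent_space S q \<and> push M q (X' q) = X q)"

lemma restricts_toD:
  assumes "restricts_to M S W X X'"
  shows "smooth_vfield M W X" "q \<in> W \<Longrightarrow> q \<in> points S \<Longrightarrow> X' q \<in> tangent_space S q"
    "q \<in> W \<Longrightarrow> q \<in> points S \<Longrightarrow> push M q (X' q) = X q"
  using assms unfolding restricts_to_def by blast+

lemma restricts_to_subset:
  assumes "restricts_to M S W X X'" "openin (mtop M) V" "V \<subseteq> W"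
  shows "restricts_to M S V X X'"
  using assms smooth_vfield_subset[of M W X V] unfolding restricts_to_def by blast

lemma restricts_to_exists:
  assumes "smooth_vfield M W X" "\<And>q. q \<in> W \<Longrightarrow> q \<in> points S \<Longrightarrow> X q \<in> tangent_in M S q"
  obtains X' where "restricts_to M S W X X'"
proof
  show "restricts_to M S W X (\<lambda>q. inv_into (tangent_space S q) (push M q) (X q))"
    unfolding restricts_to_def
  proof (intro conjI ballI assms(1))
    fix q assume "q \<in> W \<inter> points S"
    then have "X q \<in> push M q ` tangent_space S q" using assms(2) by (auto simp: tangent_in_def)
    then show "inv_into (tangent_space S q) (push M q) (X q) \<in> tangent_space S q"
      "push M q (inv_into (tangent_space S q) (push M q) (X q)) = X q"
      by (rule inv_into_into, rule f_inv_into_f)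
  qed
qed

lemma restricts_to_apply:
  assumes "restricts_to M S W X X'" "q \<in> W" "q \<in> points S" "smooth_near M q h"
  shows "X' q h = X q h"
  using restricts_toD(3)[OF assms(1-3), symmetric] assms(4) by (simp add: push_def)

text \<open>Smoothness of \<open>X'\<close> is tested on functions \<open>h\<close> on
  \<open>S\<close>. Extending \<open>h\<close> locally to \<open>H\<close> on \<open>M\<close> makes
  \<open>X' h\<close> the restriction of the smooth function \<open>X H\<close>.\<close>

lemma restricts_to_smooth_vfield:
  assumes E: "embedded_submanifold M S" and X: "restricts_to M S W X X'"
  shows "smooth_vfield S (W \<inter> points S) X'"
proof (rule smooth_vfieldI)
  note M = embedded_submanifoldD(1)[OF E] and S = embedded_submanifoldD(2)[OF E]
  have sX: "smooth_vfield M W X" using X by (rule restricts_toD)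
  show "openin (mtop S) (W \<inter> points S)" by (rule openin_submanifold[OF E smooth_vfieldD(1)[OF sX]])
  show "X' p \<in> tangent_space S p" if "p \<in> W \<inter> points S" for p
    using restricts_toD(2)[OF X] that by blast
  fix V h assume V: "V \<subseteq> W \<inter> points S" and h: "smooth_fun S V h"
  show "smooth_fun S V (\<lambda>p. X' p h)"
  proof (rule smooth_fun_local[OF S])
    fix p assume p: "p \<in> V"
    then have "p \<in> points S" using V by blast
    from slice_chart_exists[OF E this] obtain U x y L where s: "slice_chart M S U x y L" and U: "p \<in> U" .
    from slice_chart.smooth_fun_extend[OF s h p U] obtain W1 H where
      W1: "p \<in> W1" "smooth_fun M W1 H" "\<forall>q\<in>W1 \<inter> points S. q \<in> V \<and> H q = h q" by blast
    define W2 where "W2 = W1 \<inter> W"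
    have o2: "openin (mtop M) W2" using smooth_funD(1)[OF W1(2)] smooth_vfieldD(1)[OF sX] by (simp add: W2_def openin_Int)
    have H2: "smooth_fun M W2 H" by (rule smooth_fun_subset[OF W1(2) o2]) (simp add: W2_def)
    have sub: "W2 \<inter> points S \<subseteq> V" using W1(3) by (auto simp: W2_def)
    have XH: "smooth_fun S (W2 \<inter> points S) (\<lambda>q. X q H)"
      by (rule smooth_fun_restrict[OF E smooth_vfieldD(3)[OF sX _ H2]]) (simp add: W2_def)
    have HS: "smooth_fun S (W2 \<inter> points S) H" by (rule smooth_fun_restrict[OF E H2])
    have hS: "smooth_fun S (W2 \<inter> points S) h" by (rule smooth_fun_subset[OF h smooth_funD(1)[OF HS] sub])
    have "smooth_fun S (W2 \<inter> points S) (\<lambda>q. X' q h)"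
    proof (rule smooth_fun_cong[OF S XH])
      fix q assume q: "q \<in> W2 \<inter> points S"
      have t: "X' q \<in> tangent_space S q" using restricts_toD(2)[OF X] q by (simp add: W2_def)
      have "X' q H = X' q h" by (rule tangent_cong[OF t HS hS q]) (use W1(3) in \<open>simp add: W2_def\<close>)
      moreover have "X' q H = X q H"
        by (rule restricts_to_apply[OF X _ _ smooth_fun_near[OF H2]]) (use q in \<open>auto simp: W2_def\<close>)
      ultimately show "X q H = X' q h" by simp
    qed
    moreover have "p \<in> W2 \<inter> points S" using p V W1(1) by (auto simp: W2_def)
    ultimately show "\<exists>V'. p \<in> V' \<and> V' \<subseteq> V \<and> smooth_fun S V' (\<lambda>p. X' p h)" using sub by blast
  qed
qed

text \<open>For \<open>h\<close> on \<open>M\<close>, the function \<open>Y' h\<close> is the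
  restriction of \<open>Y h\<close>, so second derivatives along related fields agree;
  \<open>key\<close> is used for both orders of the two fields.\<close>

lemma push_lie_bracket:
  assumes E: "embedded_submanifold M S" and X: "restricts_to M S W X X'" and Y: "restricts_to M S W Y Y'"
    and p: "p \<in> W" "p \<in> points S"
  shows "push M p (lie_bracket S X' Y' p) = lie_bracket M X Y p"
proof
  fix h
  note M = embedded_submanifoldD(1)[OF E] and S = embedded_submanifoldD(2)[OF E]
  show "push M p (lie_bracket S X' Y' p) h = lie_bracket M X Y p h"
  proof (cases "smooth_near M p h")
    case False
    then show ?thesis by (simp add: push_def lie_bracket_def)
  next
    case True
    then obtain V where V: "p \<in> V" "smooth_fun M V h" by (auto simp: smooth_near_def)
    have key: "X' p (\<lambda>q. Y' q h) = X p (\<lambda>q. Y q h)"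
      if X: "restricts_to M S W X X'" and Y: "restricts_to M S W Y Y'" for X X' Y Y'
    proof -
      have sY: "smooth_vfield M W Y" using Y by (rule restricts_toD)
      have o: "openin (mtop M) (V \<inter> W)" using smooth_funD(1)[OF V(2)] smooth_vfieldD(1)[OF sY] by (rule openin_Int)
      have h: "smooth_fun M (V \<inter> W) h" by (rule smooth_fun_subset[OF V(2) o]) simp
      have Yh: "smooth_fun M (V \<inter> W) (\<lambda>q. Y q h)" by (rule smooth_vfieldD(3)[OF sY _ h]) simp
      have 1: "smooth_fun S ((V \<inter> W) \<inter> points S) (\<lambda>q. Y q h)" by (rule smooth_fun_restrict[OF E Yh])
      have e: "Y q h = Y' q h" if "q \<in> (V \<inter> W) \<inter> points S" for q
        using restricts_to_apply[OF Y _ _ smooth_fun_near[OF h]] that by simp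
      have 2: "smooth_fun S ((V \<inter> W) \<inter> points S) (\<lambda>q. Y' q h)" by (rule smooth_fun_cong[OF S 1 e])
      have "X' p (\<lambda>q. Y q h) = X' p (\<lambda>q. Y' q h)"
        by (rule tangent_cong[OF restricts_toD(2)[OF X p] 1 2 _ e]) (use p V in auto)
      moreover have "X' p (\<lambda>q. Y q h) = X p (\<lambda>q. Y q h)"
        by (rule restricts_to_apply[OF X p smooth_fun_near[OF Yh]]) (use p V in auto)
      ultimately show ?thesis by simp
    qed
    show ?thesis
      using True smooth_near_restrict[OF E True p(2)] key[OF X Y] key[OF Y X]
      by (simp add: push_def lie_bracket_def)
  qed
qed

subsection \<open>The Koszul formula\<close>

text \<open>The pointwise part of \<open>riemannian_metric\<close>, separated so that it serves both
  \<open>g\<close> on the tangent spaces of \<open>M\<close> and the induced metric on those of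
  \<open>S\<close>.\<close>

definition inner_on :: "'a::real_vector set \<Rightarrow> ('a \<Rightarrow> 'a \<Rightarrow> real) \<Rightarrow> bool" where
  "inner_on T G \<longleftrightarrow>
    (\<forall>u\<in>T. \<forall>v\<in>T. \<forall>w\<in>T. \<forall>a b. G (a *\<^sub>R u + b *\<^sub>R v) w = a * G u w + b * G v w) \<and>
    (\<forall>v\<in>T. \<forall>w\<in>T. G v w = G w v) \<and> (\<forall>v\<in>T. v \<noteq> 0 \<longrightarrow> G v v > 0)"

lemma inner_onD:
  assumes "inner_on T G"
  shows "u \<in> T \<Longrightarrow> v \<in> T \<Longrightarrow> w \<in> T \<Longrightarrow> G (a *\<^sub>R u + b *\<^sub>R v) w = a * G u w + b * G v w"
    and "v \<in> T \<Longrightarrow> w \<in> T \<Longrightarrow> G v w = G w v"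
    and "v \<in> T \<Longrightarrow> v \<noteq> 0 \<Longrightarrow> G v v > 0"
  using assms unfolding inner_on_def by simp_all

lemma inner_on_simps:
  assumes "inner_on T G" "u \<in> T" "w \<in> T"
  shows "G (a *\<^sub>R u) w = a * G u w" "G (- u) w = - G u w"
    and "v \<in> T \<Longrightarrow> G (u - v) w = G u w - G v w"
    and "G 0 w = 0"
  using inner_onD(1)[OF assms(1,2,2,3), of a 0] inner_onD(1)[OF assms(1,2,2,3), of "-1" 0]
    inner_onD(1)[OF assms(1,2) _ assms(3), of v 1 "-1"]
    inner_onD(1)[OF assms(1,2,2,3), of 0 0]
  by simp_all

lemma inner_on_eqI:
  assumes "inner_on T G" "u \<in> T" "v \<in> T" "u - v \<in> T" "\<And>w. w \<in> T \<Longrightarrow> G u w = G v w"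
  shows "u = v"
proof (rule ccontr)
  assume "u \<noteq> v"
  then have "G (u - v) (u - v) > 0" using inner_onD(3)[OF assms(1,4)] by simp
  then show False using inner_on_simps(3)[OF assms(1,2,4,3)] assms(4,5) by simp
qed

lemma riemannian_metric_inner_on:
  assumes "riemannian_metric M g" "p \<in> points M"
  shows "inner_on (tangent_space M p) (g p)"
  using assms unfolding riemannian_metric_def inner_on_def by simp

lemma riemannian_metric_smooth:
  assumes "riemannian_metric M g" "smooth_vfield M W X" "smooth_vfield M W Y"
  shows "smooth_fun M W (\<lambda>p. g p (X p) (Y p))"
  using assms(1)[unfolded riemannian_metric_def, THEN conjunct2, THEN conjunct2, THEN conjunct2, rule_format, of W X Y]
    assms(2,3) by simp

text \<open>Positivity is where the injectivity of the differential of the inclusion enters.\<close>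

lemma induced_metric_inner_on:
  assumes E: "embedded_submanifold M S" and g: "riemannian_metric M g" and p: "p \<in> points S"
  shows "inner_on (tangent_space S p) (induced_metric M g p)"
proof -
  have I: "inner_on (tangent_space M p) (g p)"
    using riemannian_metric_inner_on[OF g] embedded_submanifoldD(3)[OF E] p by blast
  note T = push_in_tangent_space[OF E p]
  have "push M p v \<noteq> 0" if "v \<in> tangent_space S p" "v \<noteq> 0" for v
    using push_eq_0[OF E p] that by blast
  then show ?thesis
    unfolding inner_on_def induced_metric_def
    using inner_onD[OF I] T by (simp add: push_scaleR_add)
qed

text \<open>Twice g(nabla_X Y, Z) for the Levi-Civita connection, written without the
  connection.\<close>

definition koszul ::
    "('m, 'e::euclidean_space) manifold \<Rightarrow> ('m \<Rightarrow> 'm tvec \<Rightarrow> 'm tvec \<Rightarrow> real) \<Rightarrow>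
     'm vfield \<Rightarrow> 'm vfield \<Rightarrow> 'm vfield \<Rightarrow> 'm \<Rightarrow> real" where
  "koszul M g X Y Z p =
    X p (\<lambda>q. g q (Y q) (Z q)) + Y p (\<lambda>q. g q (X q) (Z q)) - Z p (\<lambda>q. g q (X q) (Y q))
    + g p (lie_bracket M X Y p) (Z p) - g p (lie_bracket M X Z p) (Y p) - g p (lie_bracket M Y Z p) (X p)"

lemma affine_connectionD:
  assumes "affine_connection M nabla" "smooth_vfield M W Y" "p \<in> W"
  shows "v \<in> tangent_space M p \<Longrightarrow> nabla p v Y \<in> tangent_space M p"
    and "v \<in> tangent_space M p \<Longrightarrow> w \<in> tangent_space M p \<Longrightarrow>
      nabla p (a *\<^sub>R v + b *\<^sub>R w) Y = a *\<^sub>R nabla p v Y + b *\<^sub>R nabla p w Y"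
    and "smooth_fun M W h \<Longrightarrow> v \<in> tangent_space M p \<Longrightarrow>
      nabla p v (\<lambda>q. h q *\<^sub>R Y q) = v h *\<^sub>R Y p + h p *\<^sub>R nabla p v Y"
    and "smooth_vfield M W Z \<Longrightarrow> (\<And>q. q \<in> W \<Longrightarrow> Y q = Z q) \<Longrightarrow> v \<in> tangent_space M p \<Longrightarrow>
      nabla p v Y = nabla p v Z"
proof -
  note A = assms(1)[unfolded affine_connection_def]
  show "v \<in> tangent_space M p \<Longrightarrow> nabla p v Y \<in> tangent_space M p"
    using A[THEN conjunct1, rule_format, OF conjI[OF assms(2,3)]] by simp
  show "v \<in> tangent_space M p \<Longrightarrow> w \<in> tangent_space M p \<Longrightarrow>
      nabla p (a *\<^sub>R v + b *\<^sub>R w) Y = a *\<^sub>R nabla p v Y + b *\<^sub>R nabla p w Y"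
    using A[THEN conjunct1, rule_format, OF conjI[OF assms(2,3)]] by simp
  show "smooth_fun M W h \<Longrightarrow> v \<in> tangent_space M p \<Longrightarrow>
      nabla p v (\<lambda>q. h q *\<^sub>R Y q) = v h *\<^sub>R Y p + h p *\<^sub>R nabla p v Y"
    using A[THEN conjunct2, THEN conjunct2, THEN conjunct1, rule_format, of W Y h p v] assms(2,3) by simp
  show "smooth_vfield M W Z \<Longrightarrow> (\<And>q. q \<in> W \<Longrightarrow> Y q = Z q) \<Longrightarrow> v \<in> tangent_space M p \<Longrightarrow>
      nabla p v Y = nabla p v Z"
    using A[THEN conjunct2, THEN conjunct2, THEN conjunct2, THEN conjunct1, rule_format, of W Y Z p v] assms(2,3)
    by blast
qed

lemma levi_civitaD:
  assumes "levi_civita M g nabla"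
  shows "affine_connection M nabla"
    and "smooth_vfield M W X \<Longrightarrow> smooth_vfield M W Y \<Longrightarrow> p \<in> W \<Longrightarrow>
      nabla p (X p) Y - nabla p (Y p) X = lie_bracket M X Y p"
    and "smooth_vfield M W Y \<Longrightarrow> smooth_vfield M W Z \<Longrightarrow> p \<in> W \<Longrightarrow> v \<in> tangent_space M p \<Longrightarrow>
      v (\<lambda>q. g q (Y q) (Z q)) = g p (nabla p v Y) (Z p) + g p (Y p) (nabla p v Z)"
proof -
  note A = assms[unfolded levi_civita_def]
  show "affine_connection M nabla" by (rule A[THEN conjunct1])
  show "smooth_vfield M W X \<Longrightarrow> smooth_vfield M W Y \<Longrightarrow> p \<in> W \<Longrightarrow>
      nabla p (X p) Y - nabla p (Y p) X = lie_bracket M X Y p"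
    using A[THEN conjunct2, THEN conjunct1, rule_format, of W X Y p] by simp
  show "smooth_vfield M W Y \<Longrightarrow> smooth_vfield M W Z \<Longrightarrow> p \<in> W \<Longrightarrow> v \<in> tangent_space M p \<Longrightarrow>
      v (\<lambda>q. g q (Y q) (Z q)) = g p (nabla p v Y) (Z p) + g p (Y p) (nabla p v Z)"
    using A[THEN conjunct2, THEN conjunct2, rule_format, of W Y Z p v] by simp
qed

lemma koszul_formula:
  assumes lc: "levi_civita M g nabla" and I: "inner_on (tangent_space M p) (g p)"
    and X: "smooth_vfield M W X" and Y: "smooth_vfield M W Y" and Z: "smooth_vfield M W Z" and p: "p \<in> W"
  shows "2 * g p (nabla p (X p) Y) (Z p) = koszul M g X Y Z p"
proof -
  note T = smooth_vfieldD(2)[OF X p] smooth_vfieldD(2)[OF Y p] smooth_vfieldD(2)[OF Z p]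
  note nT = affine_connectionD(1)[OF levi_civitaD(1)[OF lc] X p] affine_connectionD(1)[OF levi_civitaD(1)[OF lc] Y p]
    affine_connectionD(1)[OF levi_civitaD(1)[OF lc] Z p]
  note L = levi_civitaD(2)[OF lc _ _ p, symmetric] and m = levi_civitaD(3)[OF lc _ _ p]
  show ?thesis
    unfolding koszul_def L[OF X Y] L[OF X Z] L[OF Y Z] m[OF Y Z T(1)] m[OF X Z T(2)] m[OF X Y T(3)]
    using T nT inner_on_simps(3)[OF I] inner_onD(2)[OF I]
    by simp
qed

text \<open>Bracket terms scale by e^f, and each of the three derivative terms yields one extra
  summand from differentiating this factor. Combined with \<open>koszul_formula\<close> for both
  metrics, this compares the two connections without their difference tensor.\<close>

lemma koszul_conformal:
  assumes M: "smooth_manifold M" and g: "riemannian_metric M g" and f: "smooth_fun M (points M) f"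
    and X: "smooth_vfield M W X" and Y: "smooth_vfield M W Y" and Z: "smooth_vfield M W Z" and p: "p \<in> W"
  shows "koszul M (\<lambda>q v w. exp (f q) * g q v w) X Y Z p =
    exp (f p) * (koszul M g X Y Z p + X p f * g p (Y p) (Z p) + Y p f * g p (X p) (Z p) - Z p f * g p (X p) (Y p))"
proof -
  have fW: "smooth_fun M W f"
    by (rule smooth_fun_subset[OF f smooth_vfieldD(1)[OF X]]) (use smooth_vfieldD(4)[OF X] in blast)
  have key: "v (\<lambda>q. exp (f q) * g q (Y q) (Z q)) =
      exp (f p) * (v f * g p (Y p) (Z p) + v (\<lambda>q. g q (Y q) (Z q)))"
    if v: "v \<in> tangent_space M p" and YZ: "smooth_vfield M W Y" "smooth_vfield M W Z" for v Y Z
    using tangent_mult[OF v smooth_fun_near[OF smooth_fun_exp[OF M fW] p]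
        smooth_fun_near[OF riemannian_metric_smooth[OF g YZ] p]] tangent_exp[OF M v fW p]
    by (simp add: algebra_simps)
  note T = smooth_vfieldD(2)[OF X p] smooth_vfieldD(2)[OF Y p] smooth_vfieldD(2)[OF Z p]
  show ?thesis
    unfolding koszul_def key[OF T(1) Y Z] key[OF T(2) X Z] key[OF T(3) X Y]
    by (simp add: algebra_simps)
qed

text \<open>Metric, directional derivatives and brackets are all compatible with related fields, so
  the two expressions agree term by term.\<close>

lemma koszul_restrict:
  assumes E: "embedded_submanifold M S" and g: "riemannian_metric M g"
    and X: "restricts_to M S W X X'" and Y: "restricts_to M S W Y Y'" and Z: "restricts_to M S W Z Z'"
    and p: "p \<in> W" "p \<in> points S"
  shows "koszul S (induced_metric M g) X' Y' Z' p = koszul M g X Y Z p"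
proof -
  note S = embedded_submanifoldD(2)[OF E]
  have key: "X' p (\<lambda>q. induced_metric M g q (Y' q) (Z' q)) = X p (\<lambda>q. g q (Y q) (Z q))"
    if X: "restricts_to M S W X X'" and Y: "restricts_to M S W Y Y'" and Z: "restricts_to M S W Z Z'" for X X' Y Y' Z Z'
  proof -
    have s: "smooth_fun M W (\<lambda>q. g q (Y q) (Z q))"
      by (rule riemannian_metric_smooth[OF g restricts_toD(1)[OF Y] restricts_toD(1)[OF Z]])
    have 1: "smooth_fun S (W \<inter> points S) (\<lambda>q. g q (Y q) (Z q))" by (rule smooth_fun_restrict[OF E s])
    have e: "g q (Y q) (Z q) = induced_metric M g q (Y' q) (Z' q)" if "q \<in> W \<inter> points S" for q
      using restricts_toD(3)[OF Y] restricts_toD(3)[OF Z] that by (simp add: induced_metric_def)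
    have 2: "smooth_fun S (W \<inter> points S) (\<lambda>q. induced_metric M g q (Y' q) (Z' q))" by (rule smooth_fun_cong[OF S 1 e])
    have "X' p (\<lambda>q. g q (Y q) (Z q)) = X' p (\<lambda>q. induced_metric M g q (Y' q) (Z' q))"
      by (rule tangent_cong[OF restricts_toD(2)[OF X p] 1 2 _ e]) (use p in auto)
    moreover have "X' p (\<lambda>q. g q (Y q) (Z q)) = X p (\<lambda>q. g q (Y q) (Z q))"
      by (rule restricts_to_apply[OF X p smooth_fun_near[OF s p(1)]])
    ultimately show ?thesis by simp
  qed
  show ?thesis
    unfolding koszul_def key[OF X Y Z] key[OF Y X Z] key[OF Z X Y]
    unfolding induced_metric_def push_lie_bracket[OF E X Y p] push_lie_bracket[OF E X Z p] push_lie_bracket[OF E Y Z p]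
      restricts_toD(3)[OF X p] restricts_toD(3)[OF Y p] restricts_toD(3)[OF Z p] ..
qed

text \<open>Each connection satisfies the Koszul formula of its own metric, and the Koszul
  expressions agree on related fields. Hence \<open>nabla'\<close> is the tangential part of
  \<open>nabla\<close>.\<close>

lemma gauss_formula:
  assumes E: "embedded_submanifold M S" and g: "riemannian_metric M g"
    and lc: "levi_civita M g nabla" and lc': "levi_civita S (induced_metric M g) nabla'"
    and X: "restricts_to M S W X X'" and Y: "restricts_to M S W Y Y'" and Z: "restricts_to M S W Z Z'"
    and p: "p \<in> W" "p \<in> points S"
  shows "induced_metric M g p (nabla' p (X' p) Y') (Z' p) = g p (nabla p (X p) Y) (Z p)"
proof -
  have I: "inner_on (tangent_space M p) (g p)"
    using riemannian_metric_inner_on[OF g] embedded_submanifoldD(3)[OF E] p by blast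
  have pW: "p \<in> W \<inter> points S" using p by blast
  show ?thesis
    using koszul_formula[OF lc I restricts_toD(1)[OF X] restricts_toD(1)[OF Y] restricts_toD(1)[OF Z] p(1)]
      koszul_formula[OF lc' induced_metric_inner_on[OF E g p(2)] restricts_to_smooth_vfield[OF E X]
        restricts_to_smooth_vfield[OF E Y] restricts_to_smooth_vfield[OF E Z] pW]
      koszul_restrict[OF E g X Y Z p] by simp
qed

section \<open>Tangent and normal vectors of a hypersurface\<close>

lemma normal_perp:
  assumes I: "inner_on (tangent_space M p) (g p)" and E: "embedded_submanifold M S" and p: "p \<in> points S"
    and N: "N \<in> normal_space M S g p" and v: "v \<in> tangent_in M S p"
  shows "g p N v = 0" "g p v N = 0"
proof -
  have "v \<in> tangent_space M p" using v push_in_tangent_space[OF E p] by (auto simp: tangent_in_def)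
  then show "g p N v = 0" "g p v N = 0"
    using N v inner_onD(2)[OF I] by (auto simp: normal_space_def)
qed

text \<open>A dimension count: \<open>range L\<close> has codimension one and misses the components
  \<open>b\<close> of \<open>N\<close>, so \<open>w\<close> is a tangent vector plus
  \<open>t\<close> times \<open>N\<close>. Pairing with \<open>N\<close> gives
  \<open>t = 0\<close>.\<close>

lemma perp_normal_tangent_in:
  fixes M :: "('m, 'e::euclidean_space) manifold" and S :: "('m, 'f::euclidean_space) manifold"
  assumes dim: "DIM('e) = DIM('f) + 1" and E: "embedded_submanifold M S" and p: "p \<in> points S"
    and I: "inner_on (tangent_space M p) (g p)"
    and N: "N \<in> normal_space M S g p" "g p N N = 1"
    and w: "w \<in> tangent_space M p" "g p w N = 0"
  shows "w \<in> tangent_in M S p"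
proof -
  obtain U x y L where s: "slice_chart M S U x y L" and U: "p \<in> U" by (rule slice_chart_exists[OF E p])
  interpret slice_chart M S U x y L by (rule s)
  have p': "p \<in> U \<inter> points S" using U p by blast
  have NT: "N \<in> tangent_space M p" using N(1) by (simp add: normal_space_def)
  have im: "chart_vec M U x (L u) p \<in> tangent_in M S p" for u
    using push_chart_vec[OF U p, symmetric] chart_vec_in_tangent_space[OF S d p'] by (auto simp: tangent_in_def)
  obtain a where a: "w = chart_vec M U x a p" using tangent_eq_chart_vec[OF M c U w(1)] .
  obtain b where b: "N = chart_vec M U x b p" using tangent_eq_chart_vec[OF M c U NT] .
  have sp: "span (range L) = range L" using L(1) by (simp add: linear_subspace_image span_eq_iff)
  have nb: "b \<notin> span (range L)"
  proof
    assume "b \<in> span (range L)"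
    then have "N \<in> tangent_in M S p" using im b sp by auto
    then have "g p N N = 0" by (rule normal_perp(1)[OF I E p N(1)])
    then show False using N(2) by simp
  qed
  have "dim (insert b (range L)) = DIM('e)"
    using nb dim_image_eq[OF L(1), of UNIV] L(2) dim by (simp add: dim_insert)
  then have "a \<in> span (insert b (range L))" using dim_eq_full by blast
  then obtain t where "a - t *\<^sub>R b \<in> span (range L)" by (auto simp: span_insert)
  then obtain u where "a - t *\<^sub>R b = L u" using sp by auto
  then have "a = L u + t *\<^sub>R b" by (simp add: algebra_simps)
  then have wu: "w = chart_vec M U x (L u) p + t *\<^sub>R N"
    using chart_vec_scaleR_add[OF c U, of "L u" t b] a b by simp
  have "g p w N = g p (chart_vec M U x (L u) p) N + t * g p N N"
    using inner_onD(1)[OF I chart_vec_in_tangent_space[OF M c U] NT NT, of 1 "L u" t] wu by simp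
  then have "t = 0" using normal_perp(2)[OF I E p N(1) im] N(2) w(2) by simp
  then show ?thesis using wu im by simp
qed

text \<open>Extend by constant coordinates in a chart, then remove the component along the extended normal.\<close>

lemma restricts_to_extension_exists:
  fixes M :: "('m, 'e::euclidean_space) manifold" and S :: "('m, 'f::euclidean_space) manifold"
  assumes dim: "DIM('e) = DIM('f) + 1" and E: "embedded_submanifold M S" and g: "riemannian_metric M g"
    and N: "unit_normal_field M S g N" and Z: "smooth_vfield M W0 Z" "\<And>q. q \<in> W0 \<Longrightarrow> q \<in> points S \<Longrightarrow> Z q = N q"
    and p: "p \<in> W0" "p \<in> points S" and v: "v \<in> tangent_space S p"
  obtains W X X' where "W \<subseteq> W0" "p \<in> W" "restricts_to M S W X X'" "X' p = v" "X p = push M p v"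
proof -
  note M = embedded_submanifoldD(1)[OF E] and S = embedded_submanifoldD(2)[OF E]
  have pM: "q \<in> points M" if "q \<in> points S" for q using embedded_submanifoldD(3)[OF E] that by blast
  have Nq: "N q \<in> normal_space M S g q" "g q (N q) (N q) = 1" if "q \<in> points S" for q
    using N that by (auto simp: unit_normal_field_def)
  have NT: "N q \<in> tangent_space M q" if "q \<in> points S" for q
    using Nq(1)[OF that] by (simp add: normal_space_def)
  obtain U x where c: "(U, x) \<in> atlas M" "p \<in> U" using chart_exists[OF M pM[OF p(2)]] .
  have vT: "push M p v \<in> tangent_space M p" by (rule push_in_tangent_space[OF E p(2) v])
  obtain u where u: "push M p v = chart_vec M U x u p" by (rule tangent_eq_chart_vec[OF M c vT])
  define C where "C = chart_vec M U x u"
  define W where "W = U \<inter> W0"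
  have oW: "openin (mtop M) W"
    unfolding W_def using chartD(1)[OF M c(1)] smooth_vfieldD(1)[OF Z(1)] by (rule openin_Int)
  have sC: "smooth_vfield M W C"
    unfolding C_def by (rule smooth_vfield_subset[OF smooth_vfield_chart_vec[OF M c(1)] oW]) (simp add: W_def)
  have sZ: "smooth_vfield M W Z" by (rule smooth_vfield_subset[OF Z(1) oW]) (simp add: W_def)
  \<comment> \<open>Along \<open>S\<close> the field \<open>Z\<close> is the unit vector
    \<open>N\<close>, so adding \<open>k\<close> times \<open>Z\<close> makes the field orthogonal
    to \<open>N\<close> there. Off \<open>S\<close> neither unit length nor orthogonality is
    needed.\<close>
  define k where "k = (\<lambda>q. (- 1) * g q (C q) (Z q))"
  have gCZ: "smooth_fun M W (\<lambda>q. g q (C q) (Z q))" by (rule riemannian_metric_smooth[OF g sC sZ])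
  have sk: "smooth_fun M W k"
    unfolding k_def by (rule smooth_fun_mult[OF M smooth_fun_const[OF oW] gCZ])
  define X where "X = (\<lambda>q. C q + k q *\<^sub>R Z q)"
  have kZ: "smooth_vfield M W (\<lambda>q. k q *\<^sub>R Z q)" by (rule smooth_vfield_scaleR[OF M sZ sk])
  have sX: "smooth_vfield M W X" unfolding X_def by (rule smooth_vfield_add[OF M sC kZ])
  have tan: "X q \<in> tangent_in M S q" if q: "q \<in> W" "q \<in> points S" for q
  proof (rule perp_normal_tangent_in[where g = g and p = q and N = "N q", OF dim E q(2) riemannian_metric_inner_on[OF g pM[OF q(2)]] Nq[OF q(2)]])
    note I = riemannian_metric_inner_on[OF g pM[OF q(2)]]
    show "X q \<in> tangent_space M q" by (rule smooth_vfieldD(2)[OF sX q(1)])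
    have ZN: "Z q = N q" using Z(2) q by (simp add: W_def)
    show "g q (X q) (N q) = 0"
      using inner_onD(1)[OF I smooth_vfieldD(2)[OF sC q(1)] NT[OF q(2)] NT[OF q(2)], of 1 "k q"] Nq(2)[OF q(2)]
      by (simp add: X_def ZN k_def)
  qed
  obtain X' where R: "restricts_to M S W X X'" by (rule restricts_to_exists[OF sX tan])
  have pW: "p \<in> W" using c p by (simp add: W_def)
  note I = riemannian_metric_inner_on[OF g pM[OF p(2)]]
  \<comment> \<open>The prescribed value is already tangent, so the correction vanishes at
    \<open>p\<close> and leaves it unchanged.\<close>
  have "push M p v \<in> tangent_in M S p" using v by (auto simp: tangent_in_def)
  then have "g p (C p) (Z p) = 0"
    using normal_perp(2)[OF I E p(2) Nq(1)[OF p(2)]] Z(2)[OF p] u by (simp add: C_def)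
  then have Xp: "X p = push M p v" by (simp add: X_def k_def C_def u)
  then have "X' p = v"
    using push_inject[OF E p(2) restricts_toD(2)[OF R pW p(2)] v] restricts_toD(3)[OF R pW p(2)] by simp
  then show thesis using that[OF _ pW R _ Xp] by (simp add: W_def)
qed

subsection \<open>Conformal Kenmotsu structures\<close>

lemma almost_contact_metricD:
  assumes "almost_contact_metric M \<phi> \<xi> \<eta> g"
  shows "smooth_manifold M" "smooth_endomorphism M \<phi>" "smooth_vfield M (points M) \<xi>" "riemannian_metric M g"
    and "p \<in> points M \<Longrightarrow> \<eta> p (\<xi> p) = 1" "p \<in> points M \<Longrightarrow> \<phi> p (\<xi> p) = 0"
    and "p \<in> points M \<Longrightarrow> v \<in> tangent_space M p \<Longrightarrow> \<phi> p (\<phi> p v) = - v + \<eta> p v *\<^sub>R \<xi> p"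
    and "p \<in> points M \<Longrightarrow> v \<in> tangent_space M p \<Longrightarrow> \<eta> p v = g p v (\<xi> p)"
  using assms unfolding almost_contact_metric_def by simp_all

text \<open>Taking Y = \<xi> in the Kenmotsu condition, where \<phi> \<xi> = 0, gives \<phi>(nabla_v
  \<xi>) = \<phi> v. A second application of \<phi> determines nabla_v \<xi> up to a multiple of
  \<xi>.\<close>

lemma kenmotsu_nabla_reeb:
  assumes k: "kenmotsu M \<phi> \<xi> \<eta> g"
  obtains nabla where "levi_civita M g nabla"
    and "\<And>p v. p \<in> points M \<Longrightarrow> v \<in> tangent_space M p \<Longrightarrow> nabla p v \<xi> = v - \<eta> p v *\<^sub>R \<xi> p"
proof -
  from k have ac: "almost_contact_metric M \<phi> \<xi> \<eta> g" by (simp add: kenmotsu_def)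
  from k[unfolded kenmotsu_def, THEN conjunct2] obtain nabla where lc: "levi_civita M g nabla"
    and K: "\<forall>W Y p. smooth_vfield M W Y \<and> p \<in> W \<longrightarrow>
           (\<forall>v\<in>tangent_space M p.
              nabla p v (\<lambda>q. \<phi> q (Y q)) - \<phi> p (nabla p v Y) =
              - g p v (\<phi> p (Y p)) *\<^sub>R \<xi> p - \<eta> p (Y p) *\<^sub>R \<phi> p v)" by (elim exE conjE)
  note A = almost_contact_metricD[OF ac]
  note M = A(1) and X = A(3)
  have "nabla p v \<xi> = v - \<eta> p v *\<^sub>R \<xi> p" if p: "p \<in> points M" and v: "v \<in> tangent_space M p" for p v
  proof -
    note I = riemannian_metric_inner_on[OF A(4) p]
    note aff = affine_connectionD[OF levi_civitaD(1)[OF lc] _ p]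
    define w where "w = nabla p v \<xi>"
    have wT: "w \<in> tangent_space M p" unfolding w_def by (rule aff(1)[OF X v])
    have \<xi>T: "\<xi> p \<in> tangent_space M p" by (rule smooth_vfieldD(2)[OF X p])
    note c = smooth_fun_const[OF openin_topspace, of M]
    \<comment> \<open>Writing the zero field as 0 times \<xi> lets the Leibniz rule compute its
      covariant derivative.\<close>
    have "nabla p v (\<lambda>q. 0 *\<^sub>R \<xi> q) = 0"
      using aff(3)[OF X c v, of 0] tangent_const[OF v p, of 0] by simp
    moreover have "nabla p v (\<lambda>q. \<phi> q (\<xi> q)) = nabla p v (\<lambda>q. 0 *\<^sub>R \<xi> q)"
    proof (rule aff(4)[OF _ smooth_vfield_scaleR[OF M X c] _ v])
      show "smooth_vfield M (points M) (\<lambda>q. \<phi> q (\<xi> q))"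
        using A(2)[unfolded smooth_endomorphism_def, THEN conjunct2, THEN conjunct2] X by blast
    qed (simp add: A(6))
    moreover have "g p v (\<phi> p (\<xi> p)) = 0"
      using inner_onD(2)[OF I v tangent_space_0[OF v]] inner_on_simps(4)[OF I v v] by (simp add: A(6)[OF p])
    ultimately have "\<phi> p w = \<phi> p v"
      using K[rule_format, OF conjI[OF X p] v] A(5)[OF p] by (simp add: w_def)
    then have e: "- w + \<eta> p w *\<^sub>R \<xi> p = - v + \<eta> p v *\<^sub>R \<xi> p"
      using A(7)[OF p wT] A(7)[OF p v] by simp
    \<comment> \<open>The constant length of \<xi> gives \<eta>(w) = 0, which fixes the multiple of
      \<xi> left open by \<phi>.\<close>
    have "v (\<lambda>q. g q (\<xi> q) (\<xi> q)) = v (\<lambda>q. 1)"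
      by (rule tangent_cong[OF v riemannian_metric_smooth[OF A(4) X X] c p])
        (use A(5,8) smooth_vfieldD(2)[OF X] in metis)
    then have "g p w (\<xi> p) + g p (\<xi> p) w = 0"
      using levi_civitaD(3)[OF lc X X p v] tangent_const[OF v p, of 1] by (simp add: w_def)
    then have "\<eta> p w = 0" using inner_onD(2)[OF I wT \<xi>T] A(8)[OF p wT] by simp
    then have "w = v - \<eta> p v *\<^sub>R \<xi> p" using arg_cong[OF e, of uminus] by simp
    then show ?thesis by (simp add: w_def)
  qed
  then show thesis using that[OF lc] by blast
qed

text \<open>The Kenmotsu connection is known on the rescaled field e^(-f/2) \<xi>. Comparing Koszul
  expressions carries this to \<open>nabla\<close>, and the Leibniz rule strips off the
  factor.\<close>

lemma conformal_kenmotsu_nabla_reeb: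
  assumes ck: "conformal_kenmotsu M \<phi> \<xi> \<eta> g f" and lc: "levi_civita M g nabla"
    and X: "smooth_vfield M W X" and Y: "smooth_vfield M W Y" and p: "p \<in> W"
  shows "g p (nabla p (X p) \<xi>) (Y p) =
    exp (f p / 2) * (g p (X p) (Y p) - \<eta> p (X p) * \<eta> p (Y p))
    + (Y p f * \<eta> p (X p) - \<xi> p f * g p (X p) (Y p)) / 2"
proof -
  have ac: "almost_contact_metric M \<phi> \<xi> \<eta> g" and f: "smooth_fun M (points M) f"
    and k: "kenmotsu M \<phi> (\<lambda>p. exp (- f p / 2) *\<^sub>R \<xi> p) (\<lambda>p v. exp (f p / 2) * \<eta> p v) (\<lambda>p v w. exp (f p) * g p v w)"
    using ck unfolding conformal_kenmotsu_def by blast+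
  note A = almost_contact_metricD[OF ac]
  note M = A(1)
  define s where "s = (\<lambda>q. exp (- f q / 2))"
  obtain nabla' where lc': "levi_civita M (\<lambda>p v w. exp (f p) * g p v w) nabla'"
    and n': "\<And>p v. p \<in> points M \<Longrightarrow> v \<in> tangent_space M p \<Longrightarrow>
      nabla' p v (\<lambda>p. exp (- f p / 2) *\<^sub>R \<xi> p) = v - (exp (f p / 2) * \<eta> p v) *\<^sub>R exp (- f p / 2) *\<^sub>R \<xi> p"
    by (fact kenmotsu_nabla_reeb[OF k])
  have k': "almost_contact_metric M \<phi> (\<lambda>p. exp (- f p / 2) *\<^sub>R \<xi> p) (\<lambda>p v. exp (f p / 2) * \<eta> p v) (\<lambda>p v w. exp (f p) * g p v w)"
    using k by (simp add: kenmotsu_def)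
  have pM: "p \<in> points M" by (rule smooth_vfieldD(4)[OF X p])
  have WM: "W \<subseteq> points M" using smooth_vfieldD(4)[OF X] by blast
  have oW: "openin (mtop M) W" by (rule smooth_vfieldD(1)[OF X])
  have R: "smooth_vfield M W \<xi>" by (rule smooth_vfield_subset[OF A(3) oW WM])
  have R': "smooth_vfield M W (\<lambda>q. s q *\<^sub>R \<xi> q)"
    unfolding s_def by (rule smooth_vfield_subset[OF almost_contact_metricD(3)[OF k'] oW WM])
  note I = riemannian_metric_inner_on[OF A(4) pM]
  note I' = riemannian_metric_inner_on[OF almost_contact_metricD(4)[OF k'] pM]
  note XT = smooth_vfieldD(2)[OF X p] and YT = smooth_vfieldD(2)[OF Y p] and RT = smooth_vfieldD(2)[OF R p]
  have hf: "smooth_fun M W (\<lambda>q. (- 1 / 2) * f q)"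
    by (rule smooth_fun_mult[OF M smooth_fun_const[OF oW] smooth_fun_subset[OF f oW WM]])
  \<comment> \<open>In this form \<open>tangent_exp\<close> and \<open>tangent_cmult\<close> apply
    and give the derivative of the scaling factor.\<close>
  have s_eq: "s = (\<lambda>q. exp ((- 1 / 2) * f q))" by (rule ext) (simp add: s_def)
  have ss: "smooth_fun M W s" unfolding s_eq by (rule smooth_fun_exp[OF M hf])
  have Xs: "X p s = - s p * X p f / 2"
    using tangent_exp[OF M XT hf p] tangent_cmult[OF XT smooth_fun_near[OF f pM], of "- 1 / 2"]
    by (simp add: s_eq)
  define E where "E = exp (f p / 2)"
  have E: "exp (f p) = E * E" "s p * E = 1" "E \<noteq> 0"
    by (simp_all add: E_def s_def flip: exp_add)
  have nT: "nabla p (X p) \<xi> \<in> tangent_space M p"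
    by (rule affine_connectionD(1)[OF levi_civitaD(1)[OF lc] R p XT])
  have n1: "nabla p (X p) (\<lambda>q. s q *\<^sub>R \<xi> q) = X p s *\<^sub>R \<xi> p + s p *\<^sub>R nabla p (X p) \<xi>"
    by (rule affine_connectionD(3)[OF levi_civitaD(1)[OF lc] R p ss XT])
  have 1: "g p (nabla p (X p) (\<lambda>q. s q *\<^sub>R \<xi> q)) (Y p) =
      - s p * X p f / 2 * g p (\<xi> p) (Y p) + s p * g p (nabla p (X p) \<xi>) (Y p)"
    unfolding n1 inner_onD(1)[OF I RT nT YT] Xs ..
  have 2: "g p (nabla' p (X p) (\<lambda>q. s q *\<^sub>R \<xi> q)) (Y p) = g p (X p) (Y p) - \<eta> p (X p) * g p (\<xi> p) (Y p)"
  proof -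
    have n2: "nabla' p (X p) (\<lambda>q. s q *\<^sub>R \<xi> q) = 1 *\<^sub>R X p + (- \<eta> p (X p)) *\<^sub>R \<xi> p"
      using n'[OF pM XT] E(2) by (simp add: s_def E_def mult.commute mult.left_commute)
    show ?thesis unfolding n2 inner_onD(1)[OF I XT RT YT] by simp
  qed
  \<comment> \<open>Both Levi-Civita connections are evaluated on the same fields X, e^(-f/2) \<xi>
    and Y; the common factor e^f is cancelled next.\<close>
  have "2 * (exp (f p) * g p (nabla' p (X p) (\<lambda>q. s q *\<^sub>R \<xi> q)) (Y p)) =
      exp (f p) * (2 * g p (nabla p (X p) (\<lambda>q. s q *\<^sub>R \<xi> q)) (Y p) + X p f * g p (s p *\<^sub>R \<xi> p) (Y p)
        + (s p *\<^sub>R \<xi> p) f * g p (X p) (Y p) - Y p f * g p (X p) (s p *\<^sub>R \<xi> p))"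
    using koszul_formula[OF lc' I' X R' Y p] koszul_formula[OF lc I X R' Y p]
      koszul_conformal[OF M A(4) f X R' Y p] by simp
  then have "2 * g p (nabla' p (X p) (\<lambda>q. s q *\<^sub>R \<xi> q)) (Y p) =
      2 * g p (nabla p (X p) (\<lambda>q. s q *\<^sub>R \<xi> q)) (Y p) + X p f * g p (s p *\<^sub>R \<xi> p) (Y p)
        + (s p *\<^sub>R \<xi> p) f * g p (X p) (Y p) - Y p f * g p (X p) (s p *\<^sub>R \<xi> p)"
    by (subst (asm) mult.left_commute) (simp only: mult_cancel_left exp_not_eq_zero simp_thms)
  moreover have "g p (s p *\<^sub>R \<xi> p) (Y p) = s p * \<eta> p (Y p)" "g p (X p) (s p *\<^sub>R \<xi> p) = s p * \<eta> p (X p)"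
    "g p (\<xi> p) (Y p) = \<eta> p (Y p)"
    using inner_on_simps(1)[OF I RT] inner_onD(2)[OF I XT tangent_space_scaleR[OF RT]] XT YT
      inner_onD(2)[OF I] RT A(8)[OF pM] by simp_all
  moreover have "(s p *\<^sub>R \<xi> p) f = s p * \<xi> p f" by (simp add: scaleR_fun_def)
  \<comment> \<open>The derivative X(f) occurs once from the conformal change and once, with
    opposite sign, from differentiating the scaling factor; the two cancel. Multiplying by
    \<open>E\<close>, the inverse of \<open>s p\<close>, then isolates nabla_X \<xi>.\<close>
  ultimately have "2 * (g p (X p) (Y p) - \<eta> p (X p) * \<eta> p (Y p)) =
      s p * (2 * g p (nabla p (X p) \<xi>) (Y p) + \<xi> p f * g p (X p) (Y p) - Y p f * \<eta> p (X p))"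
    by (simp add: 1 2 algebra_simps)
  then have "E * (2 * (g p (X p) (Y p) - \<eta> p (X p) * \<eta> p (Y p))) =
      (s p * E) * (2 * g p (nabla p (X p) \<xi>) (Y p) + \<xi> p f * g p (X p) (Y p) - Y p f * \<eta> p (X p))"
    by (simp add: mult_ac)
  then show ?thesis unfolding E(2) by (simp add: E_def field_simps)
qed

text \<open>Along \<open>S\<close> the function g(N, Y) vanishes, so metric compatibility moves the
  derivative from \<open>N\<close> to \<open>Y\<close>.\<close>

lemma shape_operator_formula:
  assumes E: "embedded_submanifold M S" and g: "riemannian_metric M g" and lc: "levi_civita M g nabla"
    and N: "unit_normal_field M S g N" and A: "shape_operator M S nabla N A"
    and X: "restricts_to M S W X X'" and Y: "restricts_to M S W Y Y'"
    and Z: "smooth_vfield M W Z" "\<And>q. q \<in> W \<Longrightarrow> q \<in> points S \<Longrightarrow> Z q = N q"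
    and p: "p \<in> W" "p \<in> points S"
  shows "g p (push M p (A p (X' p))) (Y p) = g p (N p) (nabla p (X p) Y)"
proof -
  note S = embedded_submanifoldD(2)[OF E]
  have pM: "q \<in> points M" if "q \<in> points S" for q using embedded_submanifoldD(3)[OF E] that by blast
  have pW: "p \<in> W \<inter> points S" using p by blast
  note I = riemannian_metric_inner_on[OF g pM]
  note XT = smooth_vfieldD(2)[OF restricts_toD(1)[OF X] p(1)]
  note YT = smooth_vfieldD(2)[OF restricts_toD(1)[OF Y] p(1)]
  have nT: "nabla p (X p) Z \<in> tangent_space M p"
    by (rule affine_connectionD(1)[OF levi_civitaD(1)[OF lc] Z(1) p(1) XT])
  have "local_extension M S N p Z"
    unfolding local_extension_def using Z p by blast
  then have "push M p (A p (X' p)) = - nabla p (push M p (X' p)) Z"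
    using A[unfolded shape_operator_def, rule_format, OF p(2) restricts_toD(2)[OF X p]] by blast
  then have 1: "g p (push M p (A p (X' p))) (Y p) = - g p (nabla p (X p) Z) (Y p)"
    using restricts_toD(3)[OF X p] inner_on_simps(2)[OF I[OF p(2)] nT YT] by simp
  have s: "smooth_fun M W (\<lambda>q. g q (Z q) (Y q))"
    by (rule riemannian_metric_smooth[OF g Z(1) restricts_toD(1)[OF Y]])
  have 2: "smooth_fun S (W \<inter> points S) (\<lambda>q. g q (Z q) (Y q))" by (rule smooth_fun_restrict[OF E s])
  \<comment> \<open>This function vanishes along \<open>S\<close> only, so it is differentiated by
    the derivation \<open>X'\<close> of \<open>S\<close>, which agrees with \<open>X\<close> on
    it.\<close>
  have "X' p (\<lambda>q. g q (Z q) (Y q)) = X' p (\<lambda>q. 0)"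
  proof (rule tangent_cong[OF restricts_toD(2)[OF X p] 2 smooth_fun_const[OF smooth_funD(1)[OF 2]] pW])
    fix q assume q: "q \<in> W \<inter> points S"
    then have qS: "q \<in> points S" by blast
    have "Y q \<in> tangent_in M S q"
      unfolding tangent_in_def using restricts_toD(2,3)[OF Y, of q] q by (metis IntD1 IntD2 imageI)
    moreover have "N q \<in> normal_space M S g q" using N qS by (simp add: unit_normal_field_def)
    ultimately show "g q (Z q) (Y q) = 0" using normal_perp(1)[where g = g and p = q and N = "N q", OF I[OF qS] E qS] Z(2) q by simp
  qed
  moreover have "X' p (\<lambda>q. g q (Z q) (Y q)) = X p (\<lambda>q. g q (Z q) (Y q))"
    by (rule restricts_to_apply[OF X p smooth_fun_near[OF s p(1)]])
  ultimately have "X p (\<lambda>q. g q (Z q) (Y q)) = 0"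
    using tangent_const[OF restricts_toD(2)[OF X p] p(2), of 0] by simp
  then show ?thesis
    using 1 Z(2)[OF p] levi_civitaD(3)[OF lc Z(1) restricts_toD(1)[OF Y] p(1) XT] by simp
qed

section \<open>Umbilicity from a parallel shape operator\<close>

theorem corollary4p5:
  fixes M :: "('m, 'e::euclidean_space) manifold"
    and S :: "('m, 'f::euclidean_space) manifold"
    and n :: nat
    and \<phi> :: "'m \<Rightarrow> 'm tvec \<Rightarrow> 'm tvec"
    and \<xi> :: "'m vfield"
    and \<eta> :: "'m \<Rightarrow> 'm tvec \<Rightarrow> real"
    and g :: "'m \<Rightarrow> 'm tvec \<Rightarrow> 'm tvec \<Rightarrow> real"
    and f :: "'m \<Rightarrow> real"
    and c :: real
    and nabla nabla' :: "'m conn"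
    and lee N U :: "'m vfield"
    and A :: "'m \<Rightarrow> 'm tvec \<Rightarrow> 'm tvec"
    and D Dp :: "'m \<Rightarrow> 'm tvec set"
  assumes "DIM('e) = 2 * n + 1" and "DIM('f) = 2 * n"
    and "conformal_kenmotsu_space_form M \<phi> \<xi> \<eta> g f c"
    and "levi_civita M g nabla"
    and "cr_hypersurface M S \<phi> \<xi> g D Dp"
    and "unit_normal_field M S g N"
    and "\<And>p. p \<in> points S \<Longrightarrow> U p = - \<phi> p (N p)"
    and "\<And>p. p \<in> points S \<Longrightarrow> Dp p = span {U p, \<xi> p}"
    and "\<And>p. p \<in> points S \<Longrightarrow> D p = {v \<in> tangent_in M S p. \<forall>w\<in>Dp p. g p v w = 0}"
    and "levi_civita S (induced_metric M g) nabla'"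
    and "shape_operator M S nabla N A"
    and "parallel_endomorphism S nabla' A"
    and "is_sharp M g (lee_form f) lee"
    and "\<And>p. p \<in> points S \<Longrightarrow> lee p = N p"
  shows "totally_umbilic S A"
proof -
  have dim: "DIM('e) = DIM('f) + 1" using assms(1,2) by simp
  have E: "embedded_submanifold M S" and \<xi>S: "\<And>p. p \<in> points S \<Longrightarrow> \<xi> p \<in> tangent_in M S p"
    using assms(5) unfolding cr_hypersurface_def by blast+
  note M = embedded_submanifoldD(1)[OF E] and S = embedded_submanifoldD(2)[OF E]
  have pM: "q \<in> points M" if "q \<in> points S" for q using embedded_submanifoldD(3)[OF E] that by blast
  have ck: "conformal_kenmotsu M \<phi> \<xi> \<eta> g f"
    using assms(3) by (simp add: conformal_kenmotsu_space_form_def)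
  then have "almost_contact_metric M \<phi> \<xi> \<eta> g" by (simp add: conformal_kenmotsu_def)
  note ac = almost_contact_metricD[OF this]
  note g = ac(4) and lc = assms(4) and N = assms(6) and lc' = assms(10) and sh = assms(11)
  note I = riemannian_metric_inner_on[OF g pM] and I' = induced_metric_inner_on[OF E g]
  have NS: "N q \<in> normal_space M S g q" "g q (N q) (N q) = 1" if "q \<in> points S" for q
    using N that by (simp_all add: unit_normal_field_def)
  have NT: "N q \<in> tangent_space M q" if "q \<in> points S" for q
    using NS(1)[OF that] by (simp add: normal_space_def)
  have perp: "g q (N q) w = 0" "g q w (N q) = 0" if q: "q \<in> points S" and w: "w \<in> tangent_in M S q" for q w
    using normal_perp[where g = g and p = q and N = "N q", OF I[OF q] E q NS(1)[OF q] w] .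
  have df: "w f = g q (N q) w" if "q \<in> points S" "w \<in> tangent_space M q" for q w
    using assms(13)[unfolded is_sharp_def, rule_format, OF pM[OF that(1)]] that assms(14)[OF that(1)]
    by (simp add: lee_form_def)
  have tan: "X q \<in> tangent_in M S q" if "restricts_to M S W X X'" "q \<in> W" "q \<in> points S" for W X X' q
    unfolding tangent_in_def using restricts_toD(2,3)[OF that] by (metis imageI)
  \<comment> \<open>\<open>nabla'\<close> and \<open>A\<close> act on derivations of
    \<open>S\<close>, so \<xi> is pulled back through \<open>push\<close> to a field on all of
    \<open>S\<close>.\<close>
  obtain \<xi>' where R0: "restricts_to M S (points M) \<xi> \<xi>'"
    using restricts_to_exists[OF ac(3) \<xi>S] by blast
  have \<xi>': "\<xi>' q \<in> tangent_space S q" "push M q (\<xi>' q) = \<xi> q" if "q \<in> points S" for q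
    using restricts_toD(2,3)[OF R0 pM[OF that] that] .
  have \<eta>: "\<eta> q (push M q w) = induced_metric M g q (\<xi>' q) w" if q: "q \<in> points S" and w: "w \<in> tangent_space S q" for q w
    using ac(8)[OF pM[OF q] push_in_tangent_space[OF E q w]] inner_onD(2)[OF I'[OF q] w \<xi>'(1)[OF q]] \<xi>'(2)[OF q]
    by (simp add: induced_metric_def)

  \<comment> \<open>Both identities are tested against tangent vectors \<open>w\<close>, as the
    Koszul formula delivers them; nondegeneracy turns them into vector identities later. They share
    the same local extensions of the normal field and of the tangent vectors.\<close>
  have n\<xi>: "induced_metric M g q (nabla' q v \<xi>') w = exp (f q / 2) *
        (induced_metric M g q v w - induced_metric M g q (\<xi>' q) v * induced_metric M g q (\<xi>' q) w)" (is ?T1)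
    and A\<xi>: "induced_metric M g q (A q (\<xi>' q)) w = induced_metric M g q (\<xi>' q) w / 2" (is ?T2)
    if q: "q \<in> points S" and v: "v \<in> tangent_space S q" and w: "w \<in> tangent_space S q" for q v w
  proof -
    obtain W0 Z where Z0: "smooth_vfield M W0 Z" "q \<in> W0" "\<forall>r\<in>W0 \<inter> points S. Z r = N r"
      using N q unfolding unit_normal_field_def local_extension_def by blast
    have ZN: "Z r = N r" if "r \<in> W0" "r \<in> points S" for r using Z0(3) that by blast
    obtain W1 X X' where X: "W1 \<subseteq> W0" "q \<in> W1" "restricts_to M S W1 X X'" "X' q = v" "X q = push M q v"
      by (rule restricts_to_extension_exists[OF dim E g N Z0(1) ZN Z0(2) q v])
    obtain W2 Y Y' where Y: "W2 \<subseteq> W0" "q \<in> W2" "restricts_to M S W2 Y Y'" "Y' q = w" "Y q = push M q w"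
      by (rule restricts_to_extension_exists[OF dim E g N Z0(1) ZN Z0(2) q w])
    define W where "W = W1 \<inter> W2"
    have oW: "openin (mtop M) W" unfolding W_def
      using smooth_vfieldD(1)[OF restricts_toD(1)[OF X(3)]] smooth_vfieldD(1)[OF restricts_toD(1)[OF Y(3)]]
      by (rule openin_Int)
    have qW: "q \<in> W" using X(2) Y(2) by (simp add: W_def)
    have RX: "restricts_to M S W X X'" by (rule restricts_to_subset[OF X(3) oW]) (simp add: W_def)
    have RY: "restricts_to M S W Y Y'" by (rule restricts_to_subset[OF Y(3) oW]) (simp add: W_def)
    have R\<xi>: "restricts_to M S W \<xi> \<xi>'" by (rule restricts_to_subset[OF R0 oW openin_subset[OF oW]])
    have WW0: "W \<subseteq> W0" using X(1) by (auto simp: W_def)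
    have sZ: "smooth_vfield M W Z" by (rule smooth_vfield_subset[OF Z0(1) oW WW0])
    have ZW: "Z r = N r" if "r \<in> W" "r \<in> points S" for r using ZN WW0 that by blast
    note sX = restricts_toD(1)[OF RX] and sY = restricts_toD(1)[OF RY] and s\<xi> = restricts_toD(1)[OF R\<xi>]
    note YT = smooth_vfieldD(2)[OF sY qW] and \<xi>T = smooth_vfieldD(2)[OF s\<xi> qW]
    \<comment> \<open>The gradient of f is normal along \<open>S\<close>, so tangent vectors
      annihilate f; this removes the derivative terms from the Reeb formula in tangent
      directions.\<close>
    have Yf: "Y q f = 0" using df[OF q YT] perp(1)[OF q tan[OF RY qW q]] by simp
    have \<xi>f: "\<xi> q f = 0" using df[OF q \<xi>T] perp(1)[OF q tan[OF R\<xi> qW q]] by simp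
    show ?T1
      using gauss_formula[OF E g lc lc' RX R\<xi> RY qW q] conformal_kenmotsu_nabla_reeb[OF ck lc sX sY qW]
        \<eta>[OF q v] \<eta>[OF q w] Yf \<xi>f
      by (simp add: X(4,5) Y(4,5) induced_metric_def)
    \<comment> \<open>By torsion-freeness the difference is a bracket of fields tangent to
      \<open>S\<close>, hence orthogonal to N: this is the symmetry of the second fundamental form
      for \<xi> and Y.\<close>
    have "nabla q (\<xi> q) Y - nabla q (Y q) \<xi> = push M q (lie_bracket S \<xi>' Y' q)"
      using levi_civitaD(2)[OF lc s\<xi> sY qW] push_lie_bracket[OF E R\<xi> RY qW q] by simp
    \<comment> \<open>Torsion-freeness of \<open>nabla'\<close> presents the bracket as a difference
      of tangent vectors, so the derivation laws need no separate check.\<close>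
    moreover have "lie_bracket S \<xi>' Y' q \<in> tangent_space S q"
    proof -
      have qS: "q \<in> W \<inter> points S" using qW q by blast
      note s' = restricts_to_smooth_vfield[OF E R\<xi>] restricts_to_smooth_vfield[OF E RY]
      note aff = affine_connectionD(1)[OF levi_civitaD(1)[OF lc'] _ qS]
      show ?thesis
        using tangent_space_diff[OF aff[OF s'(2) smooth_vfieldD(2)[OF s'(1) qS]] aff[OF s'(1) smooth_vfieldD(2)[OF s'(2) qS]]]
          levi_civitaD(2)[OF lc' s' qS] by simp
    qed
    ultimately have "g q (nabla q (\<xi> q) Y - nabla q (Y q) \<xi>) (N q) = 0"
      using perp(2)[OF q] by (simp add: tangent_in_def)
    moreover have n1: "nabla q (\<xi> q) Y \<in> tangent_space M q" "nabla q (Y q) \<xi> \<in> tangent_space M q"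
      using affine_connectionD(1)[OF levi_civitaD(1)[OF lc] sY qW \<xi>T]
        affine_connectionD(1)[OF levi_civitaD(1)[OF lc] s\<xi> qW YT] .
    ultimately have "g q (nabla q (\<xi> q) Y) (N q) = g q (nabla q (Y q) \<xi>) (N q)"
      using inner_on_simps(3)[OF I[OF q] n1(1) NT[OF q] n1(2)] by simp
    \<comment> \<open>The Reeb formula is used with the extension of N as test field: the
      exponential terms vanish because g(Y, N) = 0 and \<eta>(N) = 0, and N(f) = 1 leaves the
      half.\<close>
    also have "\<dots> = \<eta> q (Y q) / 2"
    proof -
      have "N q f = 1" using df[OF q NT[OF q]] NS(2)[OF q] by simp
      moreover have "\<eta> q (N q) = 0"
        using ac(8)[OF pM[OF q] NT[OF q]] perp(1)[OF q tan[OF R\<xi> qW q]] by simp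
      ultimately show ?thesis
        using conformal_kenmotsu_nabla_reeb[OF ck lc sY sZ qW] perp(2)[OF q tan[OF RY qW q]] \<xi>f
        by (simp add: ZW[OF qW q])
    qed
    finally show ?T2
      using shape_operator_formula[OF E g lc N sh R\<xi> RY sZ ZW qW q] \<eta>[OF q w]
        inner_onD(2)[OF I[OF q] n1(1) NT[OF q]]
      by (simp add: Y(4,5) induced_metric_def)
  qed

  have AT: "A q v \<in> tangent_space S q" if "q \<in> points S" "v \<in> tangent_space S q" for q v
    using sh that unfolding shape_operator_def by blast
  have A\<xi>': "A q (\<xi>' q) = (1 / 2) *\<^sub>R \<xi>' q" if q: "q \<in> points S" for q
  proof (rule inner_on_eqI[OF I'[OF q] AT[OF q \<xi>'(1)[OF q]]])
    show T: "(1 / 2) *\<^sub>R \<xi>' q \<in> tangent_space S q" by (rule tangent_space_scaleR[OF \<xi>'(1)[OF q]])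
    show "A q (\<xi>' q) - (1 / 2) *\<^sub>R \<xi>' q \<in> tangent_space S q"
      by (rule tangent_space_diff[OF AT[OF q \<xi>'(1)[OF q]] T])
    show "induced_metric M g q (A q (\<xi>' q)) w = induced_metric M g q ((1 / 2) *\<^sub>R \<xi>' q) w"
      if "w \<in> tangent_space S q" for w
      using A\<xi>[OF q \<xi>'(1)[OF q] that] inner_on_simps(1)[OF I'[OF q] \<xi>'(1)[OF q] that, of "1 / 2"] by simp
  qed
  have s\<xi>': "smooth_vfield S (points S) \<xi>'"
    using restricts_to_smooth_vfield[OF E R0] embedded_submanifoldD(3)[OF E] by (simp add: Int_absorb1)

  have "A p v = (1 / 2) *\<^sub>R v" if p: "p \<in> points S" and v: "v \<in> tangent_space S p" for p v
  proof -
    define e where "e = exp (f p / 2)"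
    define b where "b = induced_metric M g p (\<xi>' p) v"
    note aff = affine_connectionD[OF levi_civitaD(1)[OF lc'] s\<xi>' p]
    \<comment> \<open>This is e^(f/2) (v - \<eta>(v) \<xi>), the expected value of nabla'_v \<xi>',
      since \<open>b\<close> is \<eta>(v).\<close>
    define w where "w = e *\<^sub>R v + (- e * b) *\<^sub>R \<xi>' p"
    have wT: "w \<in> tangent_space S p" unfolding w_def by (rule tangent_space_scaleR_add[OF v \<xi>'(1)[OF p]])
    note nT = aff(1)[OF v]
    have n: "nabla' p v \<xi>' = w"
    proof (rule inner_on_eqI[OF I'[OF p] nT wT tangent_space_diff[OF nT wT]])
      show "induced_metric M g p (nabla' p v \<xi>') u = induced_metric M g p w u" if u: "u \<in> tangent_space S p" for u
        unfolding w_def inner_onD(1)[OF I'[OF p] v \<xi>'(1)[OF p] u] n\<xi>[OF p v u]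
        by (simp add: e_def b_def algebra_simps)
    qed
    have c: "smooth_fun S (points S) (\<lambda>q. 1 / 2)" by (rule smooth_fun_const[OF openin_topspace])
    have h: "smooth_vfield S (points S) (\<lambda>q. (1 / 2) *\<^sub>R \<xi>' q)" by (rule smooth_vfield_scaleR[OF S s\<xi>' c])
    \<comment> \<open>Smoothness of A \<xi>' is inherited from its expression as half of \<xi>';
      \<open>A\<close> itself is only a family of pointwise maps.\<close>
    have h': "smooth_vfield S (points S) (\<lambda>q. A q (\<xi>' q))"
      by (rule smooth_vfield_cong[OF S h]) (simp add: A\<xi>')
    \<comment> \<open>Parallelism lets \<open>A\<close> pass through \<open>nabla'\<close>, so the
      eigenvector equation for \<xi>' is inherited by its derivative \<open>w\<close>.\<close>
    have "A p w = nabla' p v (\<lambda>q. A q (\<xi>' q))"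
      using assms(12)[unfolded parallel_endomorphism_def, rule_format, OF conjI[OF s\<xi>' p] v] n by simp
    also have "\<dots> = nabla' p v (\<lambda>q. (1 / 2) *\<^sub>R \<xi>' q)"
      by (rule affine_connectionD(4)[OF levi_civitaD(1)[OF lc'] h' p h _ v]) (rule A\<xi>')
    also have "\<dots> = (1 / 2) *\<^sub>R w"
      using aff(3)[OF c v] tangent_const[OF v p, of "1 / 2"] n by simp
    finally have Aw: "A p w = (1 / 2) *\<^sub>R w" .
    \<comment> \<open>\<open>shape_operator\<close> does not state that \<open>A\<close> is linear.
      Linearity comes from that of \<open>nabla\<close> in the direction, for one fixed extension of
      N, and from the injectivity of \<open>push\<close>.\<close>
    obtain W0 Z where Z: "smooth_vfield M W0 Z" "p \<in> W0" "\<forall>r\<in>W0 \<inter> points S. Z r = N r"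
      using N p unfolding unit_normal_field_def local_extension_def by blast
    then have le: "local_extension M S N p Z" unfolding local_extension_def by blast
    have pA: "push M p (A p u) = - nabla p (push M p u) Z" if "u \<in> tangent_space S p" for u
      using sh[unfolded shape_operator_def, rule_format, OF p that] le by blast
    have "push M p (A p w) = - nabla p (push M p w) Z" by (rule pA[OF wT])
    also have "push M p w = e *\<^sub>R push M p v + (- e * b) *\<^sub>R push M p (\<xi>' p)"
      by (simp only: w_def push_scaleR_add)
    also have "nabla p \<dots> Z = e *\<^sub>R nabla p (push M p v) Z + (- e * b) *\<^sub>R nabla p (push M p (\<xi>' p)) Z"
      by (rule affine_connectionD(2)[OF levi_civitaD(1)[OF lc] Z(1,2) push_in_tangent_space[OF E p v]
          push_in_tangent_space[OF E p \<xi>'(1)[OF p]]])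
    also have "- \<dots> = push M p (e *\<^sub>R A p v + (- e * b) *\<^sub>R A p (\<xi>' p))"
      by (simp only: push_scaleR_add pA[OF v] pA[OF \<xi>'(1)[OF p]] scaleR_minus_right minus_add_distrib)
    finally have "push M p (A p w) = push M p (e *\<^sub>R A p v + (- e * b) *\<^sub>R A p (\<xi>' p))" .
    from push_inject[OF E p AT[OF p wT] tangent_space_scaleR_add[OF AT[OF p v] AT[OF p \<xi>'(1)[OF p]]] this]
    have "(1 / 2) *\<^sub>R w = e *\<^sub>R A p v + (- e * b) *\<^sub>R (1 / 2) *\<^sub>R \<xi>' p" by (simp only: Aw A\<xi>'[OF p])
    \<comment> \<open>Both sides contain \<xi>' with the same coefficient - e b / 2, so only the
      terms in \<open>v\<close> remain.\<close>
    then have "e *\<^sub>R A p v = e *\<^sub>R (1 / 2) *\<^sub>R v"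
      by (simp add: w_def scaleR_add_right algebra_simps)
    moreover have "e \<noteq> 0" by (simp add: e_def)
    ultimately show ?thesis by (simp only: scaleR_cancel_left simp_thms)
  qed
  then show ?thesis unfolding totally_umbilic_def by (intro exI[of _ "\<lambda>_. 1 / 2"]) simp
qed

end
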